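(* Let $n\ge 3$, let $\mathfrak{t}^*$ be the real vector space with basis $x_1,\dots,x_n$, and let $W$ be the group of signed permutations with an even number of sign changes: pairs $(u,\epsilon)$ with $u\in S_n$, $\epsilon\in\{\pm1\}^n$, $\epsilon_1\cdots\epsilon_n=1$, acting linearly on $\mathfrak{t}^*$ (and on $\mathbb{R}[x_1,\dots,x_n]$) by $(u,\epsilon)\cdot x_k=\epsilon_kx_{u(k)}$ (the Weyl group of type $D_n$). Let $\Delta^+=\{x_i\pm x_j:1\le i<j\le n\}$ and let $H_\alpha^*(W)$ be the ring of maps $f\colon W\to\mathbb{R}[x_1,\dots,x_n]$ with $f(ws_\beta)-f(w)\in(w\beta)\,\mathbb{R}[x_1,\dots,x_n]$ for all $w\in W$, $\beta\in\Delta^+$, where $s_\beta$ is the orthogonal reflection in $\beta$. For $I=[i_1,\dots,i_n]$ let $c_I((u,\epsilon))=(\epsilon_1x_{u(1)})^{i_1}\cdots(\epsilon_nx_{u(n)})^{i_n}$. Define sets $\mathcal{D}_m$ of multi-indices inductively: $\mathcal{D}_2=\{[0,0],[1,0],[2,0],[0,1]\}$, and for $m\ge3$, $[i_1,\dots,i_m]\in\mathcal{D}_m$ iff either $0\le i_1\le 2m-2$ and $[i_2,\dots,i_m]\in\mathcal{D}_{m-1}$, or $i_1=0$ and $[i_2-1,\dots,i_m-1]\in\mathcal{D}_{m-1}$. Then $\{c_I:I\in\mathcal{D}_n\}$ is a basis of the $\mathbb{R}[x_1,\dots,x_n]$-module $H_\alpha^*(W)$ consisting of $W$-invariant classes.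
   Context: $W$ acts on $H_\alpha^*(W)$ by $(w\cdot f)(v)=w^{-1}\cdot f(wv)$; a class is $W$-invariant if fixed by all $w\in W$. *)

theory Defs
  imports
    Complex_Main
    "HOL-Algebra.Module"
    "HOL-Library.Poly_Mapping"
    "HOL-Combinatorics.Permutations"
begin

section \<open>Real polynomials in $x_1, \dots, x_n$\<close>

text \<open>
  A monomial is a finitely supported map from variable indices to exponents. The ring
  $R[x_1, \dots, x_n]$ is carved out of the ring of polynomials in the variables
  $(x_k)_{k \in \<nat>}$ by restricting the variables that occur to the indices $1, \dots, n$.
\<close>

type_synonym rpoly = "(nat \<Rightarrow>\<^sub>0 nat) \<Rightarrow>\<^sub>0 real"

definition Const :: "real \<Rightarrow> rpoly"
  where "Const c = Poly_Mapping.single 0 c"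

definition Var :: "nat \<Rightarrow> rpoly"
  where "Var k = Poly_Mapping.single (Poly_Mapping.single k 1) 1"

definition polys :: "nat \<Rightarrow> rpoly set"
  where "polys n = {p. \<forall>m \<in> Poly_Mapping.keys p. Poly_Mapping.keys m \<subseteq> {1..n}}"

definition poly_ring :: "nat \<Rightarrow> rpoly ring"
  where "poly_ring n =
    \<lparr>carrier = polys n, monoid.mult = (*), one = 1, ring.zero = 0, add = (+)\<rparr>"

definition poly_subst :: "(nat \<Rightarrow> rpoly) \<Rightarrow> rpoly \<Rightarrow> rpoly"
  where "poly_subst g p =
    (\<Sum>m \<in> Poly_Mapping.keys p. Const (Poly_Mapping.lookup p m) *
      (\<Prod>k \<in> Poly_Mapping.keys m. g k ^ Poly_Mapping.lookup m k))"


section \<open>The Weyl group of type $D_n$\<close>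

text \<open>
  So that equality of pairs is equality in the group, both components are trivial outside
  $\{1, \dots, n\}$. The product is the one for which \<open>act\<close> below is a left action:
  $(u, \epsilon)(v, \delta) x_k = \delta_k \epsilon_{v(k)} x_{u(v(k))}$.
\<close>

type_synonym signed_perm = "(nat \<Rightarrow> nat) \<times> (nat \<Rightarrow> int)"

definition weyl_D :: "nat \<Rightarrow> signed_perm monoid"
  where "weyl_D n =
    \<lparr>carrier = {(u, \<epsilon>). u permutes {1..n} \<and> (\<forall>k \<in> {1..n}. \<epsilon> k \<in> {1, -1}) \<and>
        (\<forall>k. k \<notin> {1..n} \<longrightarrow> \<epsilon> k = 1) \<and> (\<Prod>k = 1..n. \<epsilon> k) = 1},
     monoid.mult = (\<lambda>(u, \<epsilon>) (v, \<delta>). (u \<circ> v, \<lambda>k. \<delta> k * \<epsilon> (v k))),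
     one = (id, \<lambda>_. 1)\<rparr>"

definition act :: "signed_perm \<Rightarrow> rpoly \<Rightarrow> rpoly"
  where "act w = poly_subst (\<lambda>k. of_int (snd w k) * Var (fst w k))"

text \<open>The space spanned by $x_1, \dots, x_n$, realised inside the polynomials.\<close>

definition linear_forms :: "nat \<Rightarrow> rpoly set"
  where "linear_forms n = {\<Sum>k = 1..n. Const (a k) * Var k | a. True}"

text \<open>The inner product on linear forms for which $x_1, \dots, x_n$ are orthonormal.\<close>

definition form_inner :: "nat \<Rightarrow> rpoly \<Rightarrow> rpoly \<Rightarrow> real"
  where "form_inner n p q =
    (\<Sum>k = 1..n. Poly_Mapping.lookup p (Poly_Mapping.single k 1) *
                Poly_Mapping.lookup q (Poly_Mapping.single k 1))"

definition form_reflection :: "nat \<Rightarrow> rpoly \<Rightarrow> rpoly \<Rightarrow> rpoly"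
  where "form_reflection n \<beta> p = p - Const (2 * form_inner n p \<beta> / form_inner n \<beta> \<beta>) * \<beta>"

definition pos_roots :: "nat \<Rightarrow> rpoly set"
  where "pos_roots n =
    {Var i - Var j | i j. 1 \<le> i \<and> i < j \<and> j \<le> n} \<union>
    {Var i + Var j | i j. 1 \<le> i \<and> i < j \<and> j \<le> n}"

text \<open>
  The reflection in a root, as an element of the group; existence and uniqueness are shown in
  \<open>refl_elt_diff\<close> and \<open>refl_elt_sum\<close>.
\<close>

definition refl_elt :: "nat \<Rightarrow> rpoly \<Rightarrow> signed_perm"
  where "refl_elt n \<beta> =
    (THE s. s \<in> carrier (weyl_D n) \<and> (\<forall>p \<in> linear_forms n. act s p = form_reflection n \<beta> p))"


section \<open>The module $H_\alpha^*(W)$\<close>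

text \<open>Maps on $W$ are extensional, so that equality of classes is equality of functions.\<close>

definition H_carrier :: "nat \<Rightarrow> (signed_perm \<Rightarrow> rpoly) set"
  where "H_carrier n =
    {f \<in> carrier (weyl_D n) \<rightarrow>\<^sub>E polys n.
      \<forall>w \<in> carrier (weyl_D n). \<forall>\<beta> \<in> pos_roots n.
        \<exists>q \<in> polys n. f (w \<otimes>\<^bsub>weyl_D n\<^esub> refl_elt n \<beta>) - f w = act w \<beta> * q}"

definition H_alpha :: "nat \<Rightarrow> (rpoly, signed_perm \<Rightarrow> rpoly) module"
  where "H_alpha n =
    \<lparr>carrier = H_carrier n,
     monoid.mult = (\<lambda>f g. \<lambda>v \<in> carrier (weyl_D n). f v * g v),
     one = (\<lambda>v \<in> carrier (weyl_D n). 1),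
     ring.zero = (\<lambda>v \<in> carrier (weyl_D n). 0),
     add = (\<lambda>f g. \<lambda>v \<in> carrier (weyl_D n). f v + g v),
     smult = (\<lambda>p f. \<lambda>v \<in> carrier (weyl_D n). p * f v)\<rparr>"

definition class_act :: "nat \<Rightarrow> signed_perm \<Rightarrow> (signed_perm \<Rightarrow> rpoly) \<Rightarrow> (signed_perm \<Rightarrow> rpoly)"
  where "class_act n w f =
    (\<lambda>v \<in> carrier (weyl_D n). act (inv\<^bsub>weyl_D n\<^esub> w) (f (w \<otimes>\<^bsub>weyl_D n\<^esub> v)))"

definition W_invariant :: "nat \<Rightarrow> (signed_perm \<Rightarrow> rpoly) \<Rightarrow> bool"
  where "W_invariant n f \<longleftrightarrow> (\<forall>w \<in> carrier (weyl_D n). class_act n w f = f)"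

definition module_basis :: "('a, 'r) ring_scheme \<Rightarrow> ('a, 'b, 'm) module_scheme \<Rightarrow> 'b set \<Rightarrow> bool"
  where "module_basis R M B \<longleftrightarrow>
    B \<subseteq> carrier M \<and>
    (\<forall>x \<in> carrier M. \<exists>F a. finite F \<and> F \<subseteq> B \<and> a \<in> F \<rightarrow> carrier R \<and>
      x = (\<Oplus>\<^bsub>M\<^esub>b \<in> F. a b \<odot>\<^bsub>M\<^esub> b)) \<and>
    (\<forall>F a. finite F \<and> F \<subseteq> B \<and> a \<in> F \<rightarrow> carrier R \<and>
      (\<Oplus>\<^bsub>M\<^esub>b \<in> F. a b \<odot>\<^bsub>M\<^esub> b) = \<zero>\<^bsub>M\<^esub> \<longrightarrow> (\<forall>b \<in> F. a b = \<zero>\<^bsub>R\<^esub>))"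


section \<open>The classes $c_I$ and their index sets\<close>

definition c_class :: "nat \<Rightarrow> nat list \<Rightarrow> signed_perm \<Rightarrow> rpoly"
  where "c_class n I =
    (\<lambda>(u, \<epsilon>) \<in> carrier (weyl_D n). \<Prod>k = 1..n. (of_int (\<epsilon> k) * Var (u k)) ^ (I ! (k - 1)))"

text \<open>
  The sets are only meaningful from index 2 on. Since all members have entries in the naturals,
  $[i_2 - 1, \dots, i_m - 1] \in \mathcal{D}_{m-1}$ means that $[i_2, \dots, i_m]$ is the
  entrywise successor of a member.
\<close>

fun D_indices :: "nat \<Rightarrow> nat list set"
  where
    "D_indices 0 = {}"
  | "D_indices (Suc 0) = {}"
  | "D_indices (Suc (Suc 0)) = {[0, 0], [1, 0], [2, 0], [0, 1]}"
  | "D_indices (Suc (Suc (Suc l))) =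
      {i # J | i J. i \<le> 2 * (l + 3) - 2 \<and> J \<in> D_indices (Suc (Suc l))} \<union>
      {0 # map Suc J | J. J \<in> D_indices (Suc (Suc l))}"


section \<open>Well-definedness\<close>

lemma polys_0 [simp]: "0 \<in> polys n"
  by (simp add: polys_def)

lemma polys_1 [simp]: "1 \<in> polys n"
  by (simp add: polys_def)

lemma polys_add [simp]: "p \<in> polys n \<Longrightarrow> q \<in> polys n \<Longrightarrow> p + q \<in> polys n"
  using Poly_Mapping.keys_add [of p q] by (fastforce simp: polys_def)

lemma polys_uminus [simp]: "p \<in> polys n \<Longrightarrow> - p \<in> polys n"
  by (simp add: polys_def)

lemma polys_diff [simp]: "p \<in> polys n \<Longrightarrow> q \<in> polys n \<Longrightarrow> p - q \<in> polys n"
  using polys_add [of p n "- q"] by simp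

lemma polys_mult [simp]: "p \<in> polys n \<Longrightarrow> q \<in> polys n \<Longrightarrow> p * q \<in> polys n"
  unfolding polys_def
proof (clarify)
  fix m k
  assume p: "\<forall>m\<in>Poly_Mapping.keys p. Poly_Mapping.keys m \<subseteq> {1..n}"
    and q: "\<forall>m\<in>Poly_Mapping.keys q. Poly_Mapping.keys m \<subseteq> {1..n}"
    and m: "m \<in> Poly_Mapping.keys (p * q)" and k: "k \<in> Poly_Mapping.keys m"
  obtain a b where ab: "m = a + b" "a \<in> Poly_Mapping.keys p" "b \<in> Poly_Mapping.keys q"
    using m Poly_Mapping.keys_mult [of p q] by blast
  have "k \<in> Poly_Mapping.keys a \<union> Poly_Mapping.keys b"
    using k ab(1) Poly_Mapping.keys_add [of a b] by blast
  then show "k \<in> {1..n}"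
    using p q ab(2,3) by blast
qed

lemma cring_poly_ring: "cring (poly_ring n)"
proof (rule cringI)
  show "abelian_group (poly_ring n)"
  proof (rule abelian_groupI)
    fix p assume "p \<in> carrier (poly_ring n)"
    then show "\<exists>q \<in> carrier (poly_ring n). q \<oplus>\<^bsub>poly_ring n\<^esub> p = \<zero>\<^bsub>poly_ring n\<^esub>"
      by (intro bexI [of _ "- p"]) (simp_all add: poly_ring_def)
  qed (simp_all add: poly_ring_def algebra_simps)
  show "comm_monoid (poly_ring n)"
    by (rule comm_monoidI) (simp_all add: poly_ring_def algebra_simps)
qed (simp add: poly_ring_def algebra_simps)

lemma weyl_D_carrier:
  "(u, \<epsilon>) \<in> carrier (weyl_D n) \<longleftrightarrow> u permutes {1..n} \<and> (\<forall>k \<in> {1..n}. \<epsilon> k \<in> {1, -1}) \<and>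
    (\<forall>k. k \<notin> {1..n} \<longrightarrow> \<epsilon> k = 1) \<and> (\<Prod>k = 1..n. \<epsilon> k) = 1"
  by (simp add: weyl_D_def)

lemma weyl_D_mult: "(u, \<epsilon>) \<otimes>\<^bsub>weyl_D n\<^esub> (v, \<delta>) = (u \<circ> v, \<lambda>k. \<delta> k * \<epsilon> (v k))"
  by (simp add: weyl_D_def)

lemma weyl_D_one: "\<one>\<^bsub>weyl_D n\<^esub> = (id, \<lambda>_. 1)"
  by (simp add: weyl_D_def)

lemma group_weyl_D: "group (weyl_D n)"
proof (rule groupI)
  fix x y
  assume "x \<in> carrier (weyl_D n)" "y \<in> carrier (weyl_D n)"
  moreover obtain u \<epsilon> v \<delta> where xy: "x = (u, \<epsilon>)" "y = (v, \<delta>)"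
    by (cases x, cases y)
  ultimately have x: "u permutes {1..n}" "\<And>k. k \<in> {1..n} \<Longrightarrow> \<epsilon> k \<in> {1, -1}"
      "\<And>k. k \<notin> {1..n} \<Longrightarrow> \<epsilon> k = 1" "(\<Prod>k = 1..n. \<epsilon> k) = 1"
    and y: "v permutes {1..n}" "\<And>k. k \<in> {1..n} \<Longrightarrow> \<delta> k \<in> {1, -1}"
      "\<And>k. k \<notin> {1..n} \<Longrightarrow> \<delta> k = 1" "(\<Prod>k = 1..n. \<delta> k) = 1"
    by (simp_all add: weyl_D_carrier)
  have v: "v k \<in> {1..n} \<longleftrightarrow> k \<in> {1..n}" for k
    using y(1) by (rule permutes_in_image)
  have "(\<Prod>k = 1..n. \<epsilon> (v k)) = (\<Prod>k = 1..n. \<epsilon> k)"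
    using prod.permute [OF y(1), of \<epsilon>] by (simp add: o_def)
  then have "(\<Prod>k = 1..n. \<delta> k * \<epsilon> (v k)) = 1"
    using x(4) y(4) by (simp add: prod.distrib)
  moreover have "\<delta> k * \<epsilon> (v k) \<in> {1, -1}" if "k \<in> {1..n}" for k
    using x(2) [of "v k"] y(2) [of k] v [of k] that by auto
  moreover have "\<delta> k * \<epsilon> (v k) = 1" if "k \<notin> {1..n}" for k
    using x(3) [of "v k"] y(3) [of k] v [of k] that by auto
  ultimately show "x \<otimes>\<^bsub>weyl_D n\<^esub> y \<in> carrier (weyl_D n)"
    using permutes_compose [OF y(1) x(1)] unfolding xy weyl_D_mult weyl_D_carrier by blast
next
  show "\<one>\<^bsub>weyl_D n\<^esub> \<in> carrier (weyl_D n)"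
    unfolding weyl_D_one weyl_D_carrier using permutes_id by auto
next
  fix x y z :: signed_perm
  show "x \<otimes>\<^bsub>weyl_D n\<^esub> y \<otimes>\<^bsub>weyl_D n\<^esub> z = x \<otimes>\<^bsub>weyl_D n\<^esub> (y \<otimes>\<^bsub>weyl_D n\<^esub> z)"
    by (cases x, cases y, cases z) (simp add: weyl_D_mult o_def mult.assoc)
next
  fix x :: signed_perm
  show "\<one>\<^bsub>weyl_D n\<^esub> \<otimes>\<^bsub>weyl_D n\<^esub> x = x"
    by (cases x) (simp add: weyl_D_mult weyl_D_one)
next
  fix x assume x: "x \<in> carrier (weyl_D n)"
  obtain u \<epsilon> where xe: "x = (u, \<epsilon>)"
    by (cases x)
  from x have u: "u permutes {1..n}" "\<And>k. k \<in> {1..n} \<Longrightarrow> \<epsilon> k \<in> {1, -1}"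
      "\<And>k. k \<notin> {1..n} \<Longrightarrow> \<epsilon> k = 1" "(\<Prod>k = 1..n. \<epsilon> k) = 1"
    by (simp_all add: weyl_D_carrier xe)
  have iu: "Hilbert_Choice.inv u permutes {1..n}"
    using u(1) by (rule permutes_inv)
  have v: "Hilbert_Choice.inv u k \<in> {1..n} \<longleftrightarrow> k \<in> {1..n}" for k
    using iu by (rule permutes_in_image)
  have "(\<Prod>k = 1..n. \<epsilon> (Hilbert_Choice.inv u k)) = 1"
    using prod.permute [OF iu, of \<epsilon>] u(4) by (simp add: o_def)
  then have c: "(Hilbert_Choice.inv u, \<lambda>k. \<epsilon> (Hilbert_Choice.inv u k)) \<in> carrier (weyl_D n)"
    unfolding weyl_D_carrier using iu u(2,3) v by blast
  have "\<epsilon> k * \<epsilon> k = 1" for k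
    using u(2) [of k] u(3) [of k] by (cases "k \<in> {1..n}") auto
  then have "(Hilbert_Choice.inv u, \<lambda>k. \<epsilon> (Hilbert_Choice.inv u k)) \<otimes>\<^bsub>weyl_D n\<^esub> x = \<one>\<^bsub>weyl_D n\<^esub>"
    using permutes_inv_o [OF u(1)] permutes_inverses [OF u(1)]
    by (simp add: xe weyl_D_mult weyl_D_one)
  with c show "\<exists>y \<in> carrier (weyl_D n). y \<otimes>\<^bsub>weyl_D n\<^esub> x = \<one>\<^bsub>weyl_D n\<^esub>"
    by blast
qed

lemma Const_0 [simp]: "Const 0 = 0"
  by (simp add: Const_def)

lemma Const_add: "Const (a + b) = Const a + Const b"
  by (simp add: Const_def single_add)

lemma Const_mult: "Const (a * b) = Const a * Const b"
  by (simp add: Const_def mult_single)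

lemma Const_of_int: "Const (of_int a) = of_int a"
  by (simp add: Const_def)

lemma lookup_Const_mult: "Poly_Mapping.lookup (Const c * p) m = c * Poly_Mapping.lookup p m"
  unfolding Const_def mult_map_scale_conv_mult [symmetric]
  by (simp add: Poly_Mapping.map.rep_eq when_def)

lemma lookup_Var: "Poly_Mapping.lookup (Var k) (Poly_Mapping.single l 1) = (if k = l then 1 else 0)"
  by (auto simp: Var_def lookup_single when_def dest: arg_cong [where f = Poly_Mapping.keys])

lemma poly_subst_superset:
  assumes "finite K" "Poly_Mapping.keys p \<subseteq> K"
  shows "poly_subst g p = (\<Sum>m \<in> K. Const (Poly_Mapping.lookup p m) *
      (\<Prod>k \<in> Poly_Mapping.keys m. g k ^ Poly_Mapping.lookup m k))"
  unfolding poly_subst_def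
  using assms by (intro sum.mono_neutral_left) (auto simp: in_keys_iff)

lemma act_add: "act w (p + q) = act w p + act w q"
proof -
  let ?K = "Poly_Mapping.keys p \<union> Poly_Mapping.keys q"
  have "Poly_Mapping.keys (p + q) \<subseteq> ?K"
    by (rule Poly_Mapping.keys_add)
  then show ?thesis
    unfolding act_def
    by (simp add: poly_subst_superset [of ?K] lookup_add Const_add algebra_simps sum.distrib)
qed

lemma act_Const_mult: "act w (Const c * p) = Const c * act w p"
proof -
  have "Poly_Mapping.keys (Const c * p) \<subseteq> Poly_Mapping.keys p"
    by (auto simp: in_keys_iff lookup_Const_mult)
  then show ?thesis
    unfolding act_def
    by (simp add: poly_subst_superset [of "Poly_Mapping.keys p"] lookup_Const_mult Const_mult
        sum_distrib_left mult.assoc)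
qed

lemma act_Var: "act (u, \<epsilon>) (Var k) = of_int (\<epsilon> k) * Var (u k)"
  by (simp add: act_def poly_subst_def) (simp add: Var_def Const_def)

lemma act_mult_Var: "act (w \<otimes>\<^bsub>weyl_D n\<^esub> v) (Var k) = act w (act v (Var k))"
  by (cases w, cases v)
    (simp add: weyl_D_mult act_Var act_Const_mult mult.assoc flip: Const_of_int,
      simp add: Const_mult)

lemma act_0: "act w 0 = 0"
  by (simp add: act_def poly_subst_def)

lemma act_sum: "act w (\<Sum>k \<in> A. p k) = (\<Sum>k \<in> A. act w (p k))"
  by (induction A rule: infinite_finite_induct) (simp_all add: act_0 act_add)

lemma act_linear_form:
  "act (u, \<epsilon>) (\<Sum>k = 1..n. Const (a k) * Var k) =
    (\<Sum>k = 1..n. Const (a k) * (of_int (\<epsilon> k) * Var (u k)))"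
  by (simp add: act_sum act_Const_mult act_Var)

lemma Var_linear_form: "k \<in> {1..n} \<Longrightarrow> Var k \<in> linear_forms n"
  unfolding linear_forms_def
proof (clarify, intro exI [of _ "\<lambda>l. if l = k then 1 else 0"] conjI TrueI)
  assume k: "k \<in> {1..n}"
  have "(\<Sum>l = 1..n. Const (if l = k then 1 else 0) * Var l) = (\<Sum>l = 1..n. if l = k then Var l else 0)"
    by (intro sum.cong) (simp_all add: Const_def)
  then show "Var k = (\<Sum>l = 1..n. Const (if l = k then 1 else 0) * Var l)"
    using k by simp
qed

text \<open>The action of the group on linear forms is faithful.\<close>

lemma act_linear_forms_inj:
  assumes "w \<in> carrier (weyl_D n)" "w' \<in> carrier (weyl_D n)"
    and eq: "\<And>p. p \<in> linear_forms n \<Longrightarrow> act w p = act w' p"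
  shows "w = w'"
proof -
  obtain u \<epsilon> v \<delta> where w: "w = (u, \<epsilon>)" "w' = (v, \<delta>)"
    by (cases w, cases w')
  have u: "u permutes {1..n}" "\<And>k. k \<in> {1..n} \<Longrightarrow> \<epsilon> k \<in> {1, -1}"
      "\<And>k. k \<notin> {1..n} \<Longrightarrow> \<epsilon> k = 1"
    and v: "v permutes {1..n}" "\<And>k. k \<notin> {1..n} \<Longrightarrow> \<delta> k = 1"
    using assms(1,2) by (simp_all add: w weyl_D_carrier)
  have "u k = v k \<and> \<epsilon> k = \<delta> k" for k
  proof (cases "k \<in> {1..n}")
    case True
    have "Const (of_int (\<epsilon> k)) * Var (u k) = Const (of_int (\<delta> k)) * Var (v k)"
      using eq [OF Var_linear_form [OF True]] by (simp add: w act_Var Const_of_int)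
    then have "Poly_Mapping.lookup (Const (of_int (\<epsilon> k)) * Var (u k)) (Poly_Mapping.single (u k) 1) =
        Poly_Mapping.lookup (Const (of_int (\<delta> k)) * Var (v k)) (Poly_Mapping.single (u k) 1)"
      by (rule arg_cong)
    then show ?thesis
      using u(2) [OF True] by (auto simp: lookup_Const_mult lookup_Var simp del: One_nat_def split: if_splits)
  next
    case False
    then show ?thesis
      using u v by (simp add: permutes_not_in)
  qed
  then show ?thesis
    by (auto simp: w)
qed

lemma refl_elt_eqI:
  assumes "s \<in> carrier (weyl_D n)"
    and "\<And>p. p \<in> linear_forms n \<Longrightarrow> act s p = form_reflection n \<beta> p"
  shows "refl_elt n \<beta> = s"
  unfolding refl_elt_def using assms by (intro the_equality) (auto intro!: act_linear_forms_inj)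

lemma refl_elt_aux:
  fixes c :: int
  assumes c: "c = 1 \<or> c = -1" and ij: "1 \<le> i" "i < j" "j \<le> n"
  defines "s \<equiv> (Transposition.transpose i j, \<lambda>k. if k = i \<or> k = j then - c else 1)"
  shows "s \<in> carrier (weyl_D n)"
    and "refl_elt n (Var i + of_int c * Var j) = s"
proof -
  have split: "(\<Sum>k = 1..n. f k) = f i + f j + (\<Sum>k \<in> {1..n} - {i, j}. f k)" for f :: "nat \<Rightarrow> 'a::comm_monoid_add"
  proof -
    have "(\<Sum>k = 1..n. f k) = (\<Sum>k \<in> {i, j} \<union> ({1..n} - {i, j}). f k)"
      using ij by (intro sum.cong) auto
    also have "\<dots> = (\<Sum>k \<in> {i, j}. f k) + (\<Sum>k \<in> {1..n} - {i, j}. f k)"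
      by (rule sum.union_disjoint) auto
    finally show ?thesis using ij by (simp add: add.assoc)
  qed
  have "(\<Prod>k = 1..n. if k = i \<or> k = j then - c else 1) =
      (\<Prod>k \<in> {i, j}. if k = i \<or> k = j then - c else 1)"
    using ij by (intro prod.mono_neutral_right) auto
  also have "\<dots> = 1"
    using ij c by auto
  finally have "(\<Prod>k = 1..n. if k = i \<or> k = j then - c else 1) = 1" .
  moreover have "Transposition.transpose i j permutes {1..n}"
    using ij by (intro permutes_swap_id) auto
  ultimately show s: "s \<in> carrier (weyl_D n)"
    unfolding s_def weyl_D_carrier using c ij by auto
  show "refl_elt n (Var i + of_int c * Var j) = s"
  proof (rule refl_elt_eqI [OF s])
    fix p assume "p \<in> linear_forms n"
    then obtain a where p: "p = (\<Sum>k = 1..n. Const (a k) * Var k)"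
      by (auto simp: linear_forms_def)
    let ?b = "Var i + Const (of_int c) * Var j"
    have lp: "Poly_Mapping.lookup p (Poly_Mapping.single k 1) = a k" if "k \<in> {1..n}" for k
    proof -
      have "Poly_Mapping.lookup p (Poly_Mapping.single k 1) = (\<Sum>l = 1..n. if l = k then a l else 0)"
        unfolding p lookup_sum lookup_Const_mult lookup_Var by (intro sum.cong) auto
      then show ?thesis using that by simp
    qed
    have lb: "Poly_Mapping.lookup ?b (Poly_Mapping.single k 1) =
        (if k = i then 1 else if k = j then of_int c else 0)" for k
      using ij by (auto simp: lookup_add lookup_Const_mult lookup_Var simp del: One_nat_def)
    have pb: "form_inner n p ?b = a i + a j * of_int c"
    proof -
      have "(\<Sum>k \<in> {1..n} - {i, j}. Poly_Mapping.lookup p (Poly_Mapping.single k 1) *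
          Poly_Mapping.lookup ?b (Poly_Mapping.single k 1)) = 0"
        by (intro sum.neutral ballI) (subst lb, auto)
      then show ?thesis
        unfolding form_inner_def split lb using ij by (simp add: lp [unfolded One_nat_def])
    qed
    have bb: "form_inner n ?b ?b = 2"
    proof -
      have "(\<Sum>k \<in> {1..n} - {i, j}. Poly_Mapping.lookup ?b (Poly_Mapping.single k 1) *
          Poly_Mapping.lookup ?b (Poly_Mapping.single k 1)) = 0"
        by (intro sum.neutral ballI) (subst lb, auto)
      then show ?thesis
        unfolding form_inner_def split lb using ij c by auto
    qed
    have "act s p = Const (a i) * (of_int (- c) * Var j) + Const (a j) * (of_int (- c) * Var i) +
        (\<Sum>k \<in> {1..n} - {i, j}. Const (a k) * Var k)"
      unfolding p s_def act_linear_form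
      unfolding split by (auto simp: transpose_apply_other intro!: sum.cong)
    also have "\<dots> = p - (Const (a i) + Const (a j) * of_int c) * (Var i + of_int c * Var j)"
      unfolding p split using c by (auto simp: algebra_simps)
    also have "\<dots> = form_reflection n ?b p"
      unfolding form_reflection_def pb bb nonzero_mult_div_cancel_left [OF zero_neq_numeral [symmetric]]
      by (simp add: Const_add Const_mult Const_of_int)
    finally show "act s p = form_reflection n (Var i + of_int c * Var j) p"
      by (simp add: Const_of_int)
  qed
qed

lemma refl_elt_diff:
  assumes "1 \<le> i" "i < j" "j \<le> n"
  shows "refl_elt n (Var i - Var j) = (Transposition.transpose i j, \<lambda>_. 1)"
  using refl_elt_aux(2) [of "-1" i j n] assms by (auto simp: fun_eq_iff)

lemma refl_elt_sum:
  assumes "1 \<le> i" "i < j" "j \<le> n"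
  shows "refl_elt n (Var i + Var j) =
    (Transposition.transpose i j, \<lambda>k. if k = i \<or> k = j then -1 else 1)"
  using refl_elt_aux(2) [of 1 i j n] assms by simp

lemma refl_elt_closed:
  assumes "\<beta> \<in> pos_roots n"
  shows "refl_elt n \<beta> \<in> carrier (weyl_D n)"
  using assms unfolding pos_roots_def
proof (elim UnE CollectE exE conjE)
  fix i j
  assume "\<beta> = Var i - Var j" "1 \<le> i" "i < j" "j \<le> n"
  then show ?thesis
    using refl_elt_aux [of "-1" i j n] by simp
next
  fix i j
  assume "\<beta> = Var i + Var j" "1 \<le> i" "i < j" "j \<le> n"
  then show ?thesis
    using refl_elt_aux [of 1 i j n] by simp
qed

lemma H_carrierI:
  assumes "\<And>v. v \<in> carrier (weyl_D n) \<Longrightarrow> f v \<in> polys n"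
    and "\<And>w s \<beta>. w \<in> carrier (weyl_D n) \<Longrightarrow> \<beta> \<in> pos_roots n \<Longrightarrow>
      s = w \<otimes>\<^bsub>weyl_D n\<^esub> refl_elt n \<beta> \<Longrightarrow> s \<in> carrier (weyl_D n) \<Longrightarrow>
      \<exists>q \<in> polys n. f s - f w = act w \<beta> * q"
  shows "(\<lambda>v \<in> carrier (weyl_D n). f v) \<in> H_carrier n"
proof -
  interpret group "weyl_D n" by (rule group_weyl_D)
  show ?thesis
    using assms by (auto simp: H_carrier_def refl_elt_closed)
qed

lemma H_carrierD:
  assumes "f \<in> H_carrier n"
  shows "v \<in> carrier (weyl_D n) \<Longrightarrow> f v \<in> polys n"
    and "w \<in> carrier (weyl_D n) \<Longrightarrow> \<beta> \<in> pos_roots n \<Longrightarrow>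
      \<exists>q \<in> polys n. f (w \<otimes>\<^bsub>weyl_D n\<^esub> refl_elt n \<beta>) - f w = act w \<beta> * q"
    and "f \<in> extensional (carrier (weyl_D n))"
  using assms by (auto simp: H_carrier_def PiE_def)

lemma H_carrier_const:
  assumes "p \<in> polys n"
  shows "(\<lambda>v \<in> carrier (weyl_D n). p) \<in> H_carrier n"
  using assms by (intro H_carrierI) (auto intro!: bexI [of _ 0])

lemma H_carrier_add:
  assumes f: "f \<in> H_carrier n" and g: "g \<in> H_carrier n"
  shows "(\<lambda>v \<in> carrier (weyl_D n). f v + g v) \<in> H_carrier n"
proof (rule H_carrierI)
  fix w s \<beta>
  assume w: "w \<in> carrier (weyl_D n)" "\<beta> \<in> pos_roots n" "s = w \<otimes>\<^bsub>weyl_D n\<^esub> refl_elt n \<beta>"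
  obtain q r where q: "q \<in> polys n" "f s - f w = act w \<beta> * q"
    and r: "r \<in> polys n" "g s - g w = act w \<beta> * r"
    using H_carrierD(2) [OF f w(1,2)] H_carrierD(2) [OF g w(1,2)] w(3) by auto
  have "f s + g s - (f w + g w) = (f s - f w) + (g s - g w)"
    by simp
  also have "\<dots> = act w \<beta> * (q + r)"
    by (simp only: q r distrib_left)
  finally show "\<exists>q \<in> polys n. f s + g s - (f w + g w) = act w \<beta> * q"
    using q(1) r(1) polys_add by blast
qed (simp add: H_carrierD(1) [OF f] H_carrierD(1) [OF g])

lemma H_carrier_mult:
  assumes f: "f \<in> H_carrier n" and g: "g \<in> H_carrier n"
  shows "(\<lambda>v \<in> carrier (weyl_D n). f v * g v) \<in> H_carrier n"
proof (rule H_carrierI)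
  fix w s \<beta>
  assume w: "w \<in> carrier (weyl_D n)" "\<beta> \<in> pos_roots n" "s = w \<otimes>\<^bsub>weyl_D n\<^esub> refl_elt n \<beta>"
    and s: "s \<in> carrier (weyl_D n)"
  obtain q r where q: "q \<in> polys n" "f s - f w = act w \<beta> * q"
    and r: "r \<in> polys n" "g s - g w = act w \<beta> * r"
    using H_carrierD(2) [OF f w(1,2)] H_carrierD(2) [OF g w(1,2)] w(3) by auto
  have "f s * g s - f w * g w = (f s - f w) * g w + f s * (g s - g w)"
    by (simp add: algebra_simps)
  also have "\<dots> = act w \<beta> * (q * g w + f s * r)"
    by (simp only: q r) (simp add: algebra_simps)
  finally show "\<exists>q \<in> polys n. f s * g s - f w * g w = act w \<beta> * q"
    using q(1) r(1) H_carrierD(1) [OF f s] H_carrierD(1) [OF g w(1)] polys_add polys_mult by blast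
qed (simp add: H_carrierD(1) [OF f] H_carrierD(1) [OF g])

lemma H_carrier_smult:
  assumes "p \<in> polys n" "f \<in> H_carrier n"
  shows "(\<lambda>v \<in> carrier (weyl_D n). p * f v) \<in> H_carrier n"
proof -
  have "(\<lambda>v \<in> carrier (weyl_D n). (\<lambda>v \<in> carrier (weyl_D n). p) v * f v) \<in> H_carrier n"
    using assms by (intro H_carrier_mult H_carrier_const)
  also have "(\<lambda>v \<in> carrier (weyl_D n). (\<lambda>v \<in> carrier (weyl_D n). p) v * f v) =
      (\<lambda>v \<in> carrier (weyl_D n). p * f v)"
    by (rule restrict_ext) simp
  finally show ?thesis .
qed

lemma H_carrier_restrict:
  "f \<in> H_carrier n \<Longrightarrow> (\<lambda>v \<in> carrier (weyl_D n). f v) = f"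
  by (simp add: H_carrierD(3) extensional_restrict)

lemma algebra_H_alpha: "algebra (poly_ring n) (H_alpha n)"
proof (rule algebraI)
  show "cring (H_alpha n)"
  proof (rule cringI)
    show "abelian_group (H_alpha n)"
    proof (rule abelian_groupI)
      fix f assume f: "f \<in> carrier (H_alpha n)"
      show "\<exists>g \<in> carrier (H_alpha n). g \<oplus>\<^bsub>H_alpha n\<^esub> f = \<zero>\<^bsub>H_alpha n\<^esub>"
      proof
        show "(\<lambda>v \<in> carrier (weyl_D n). - 1 * f v) \<in> carrier (H_alpha n)"
          using f H_carrier_smult [of "- 1" n f] by (simp add: H_alpha_def)
        show "(\<lambda>v \<in> carrier (weyl_D n). - 1 * f v) \<oplus>\<^bsub>H_alpha n\<^esub> f = \<zero>\<^bsub>H_alpha n\<^esub>"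
          by (auto simp: H_alpha_def intro!: restrict_ext)
      qed
    qed (auto simp: H_alpha_def H_carrier_add H_carrier_const H_carrier_restrict add_ac
        cong: restrict_cong)
    show "comm_monoid (H_alpha n)"
      by (rule comm_monoidI)
        (auto simp: H_alpha_def H_carrier_mult H_carrier_const H_carrier_restrict mult_ac
          cong: restrict_cong)
  qed (auto simp: H_alpha_def distrib_right intro!: restrict_ext)
qed (rule cring_poly_ring, auto simp: H_alpha_def H_carrier_smult H_carrier_restrict poly_ring_def
    algebra_simps cong: restrict_cong)

end

theory Submission
  imports Defs "HOL-Computational_Algebra.Polynomial"
begin

text \<open>
  Write $c_I(w) = w x^I$ and induct along $w \mapsto p = w x_1$, whose fibres are cosets of the Weyl
  group of type $D_{n-1}$. On the fibre over each vertex $p \in \{\pm x_k\}$ a class $f$ is a unique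
  combination $\sum_J a_J(p) c_J$ with $J \in \mathcal{D}_{n-1}$ in the variables other than $\pm p$.
  Comparing $f$ at $w$ and $s_{p-q} w$ modulo $p - q$ and using that the $c_J$ are independent even
  modulo $p - q$ gives $a_J(p) - a_J(q) \in (p - q)$ for $q \neq \pm p$.
  Such a function $a$ on the vertices is uniquely a combination of $1, p, \dots, p^{2n-2}$ and
  $x_1 \cdots x_n / p$: its even part and $p$ times its odd part are functions of $p^2 = x_k^2$ to
  which Newton interpolation applies, and the constant term of the second interpolation polynomial is
  divisible by every $x_k$. Finally $p^i c_J = c_{[i, J]}$ and
  $(x_1 \cdots x_n / p) c_J = c_{[0, J + 1]}$, which is the recursion for $\mathcal{D}_n$.
\<close>

section \<open>Substitution homomorphisms\<close>

text \<open>Type D has no root proportional to a single variable, so no condition links the values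
  at p and -p. Hence (a(p) - a(-p))/2 need not be divisible by p, and x_1...x_n/p has to join the
  powers of p. This also explains the bound 2n-2: each of the two interpolation polynomials in p^2
  has n coefficients. The first gives the even powers up to p^(2n-2); the second gives the n-1 odd
  powers up to p^(2n-3) and, through its constant term, the extra generator.

  Over a vertex with negative sign the remaining signs multiply to -1, so the fibre is the other
  coset of the smaller group. The induction therefore treats both cosets, with the product s of the
  signs and the set K of variables as parameters.

  The classes c_J on the fibres over p and q involve different variables, yet they agree modulo p -
  q once the orderings are matched by the reflection. Since the sets of variables vary, divisibility
  is studied in the ring with infinitely many variables, and the return to x_1, ..., x_n is made by
  a retraction at the end.\<close>

definition monom_subst :: "(nat \<Rightarrow> rpoly) \<Rightarrow> (nat \<Rightarrow>\<^sub>0 nat) \<Rightarrow> rpoly"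
  where "monom_subst g m = (\<Prod>k \<in> Poly_Mapping.keys m. g k ^ Poly_Mapping.lookup m k)"

lemma monom_subst_superset:
  assumes "finite K" "Poly_Mapping.keys m \<subseteq> K"
  shows "monom_subst g m = (\<Prod>k \<in> K. g k ^ Poly_Mapping.lookup m k)"
  unfolding monom_subst_def
  using assms by (intro prod.mono_neutral_left) (auto simp: in_keys_iff)

lemma monom_subst_add: "monom_subst g (m + m') = monom_subst g m * monom_subst g m'"
proof -
  let ?K = "Poly_Mapping.keys m \<union> Poly_Mapping.keys m'"
  have "Poly_Mapping.keys (m + m') \<subseteq> ?K"
    by (rule Poly_Mapping.keys_add)
  then show ?thesis
    by (simp add: monom_subst_superset [of ?K] lookup_add power_add prod.distrib)
qed

lemma poly_subst_eq_monom_subst: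
  "poly_subst g p = (\<Sum>m \<in> Poly_Mapping.keys p. Const (Poly_Mapping.lookup p m) * monom_subst g m)"
  by (simp add: poly_subst_def monom_subst_def)

lemma poly_subst_0 [simp]: "poly_subst g 0 = 0"
  by (simp add: poly_subst_def)

lemma poly_subst_add: "poly_subst g (p + q) = poly_subst g p + poly_subst g q"
proof -
  let ?K = "Poly_Mapping.keys p \<union> Poly_Mapping.keys q"
  have "Poly_Mapping.keys (p + q) \<subseteq> ?K"
    by (rule Poly_Mapping.keys_add)
  then show ?thesis
    by (simp add: poly_subst_superset [of ?K] lookup_add Const_add algebra_simps sum.distrib)
qed

lemma poly_subst_sum: "poly_subst g (\<Sum>k \<in> A. p k) = (\<Sum>k \<in> A. poly_subst g (p k))"
  by (induction A rule: infinite_finite_induct) (simp_all add: poly_subst_add)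

lemma poly_subst_single: "poly_subst g (Poly_Mapping.single m c) = Const c * monom_subst g m"
  by (cases "c = 0") (simp_all add: poly_subst_eq_monom_subst)

lemma sum_single_lookup: "(\<Sum>m \<in> Poly_Mapping.keys p. Poly_Mapping.single m (Poly_Mapping.lookup p m)) = p"
  by (rule poly_mapping_eqI) (auto simp: lookup_sum lookup_single when_def in_keys_iff)

lemma poly_subst_mult: "poly_subst g (p * q) = poly_subst g p * poly_subst g q"
proof -
  let ?s = "\<lambda>p m. Poly_Mapping.single m (Poly_Mapping.lookup p m)"
  have "p * q = (\<Sum>m \<in> Poly_Mapping.keys p. ?s p m) * (\<Sum>m \<in> Poly_Mapping.keys q. ?s q m)"
    by (simp only: sum_single_lookup)
  also have "\<dots> = (\<Sum>m \<in> Poly_Mapping.keys p. \<Sum>m' \<in> Poly_Mapping.keys q.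
      Poly_Mapping.single (m + m') (Poly_Mapping.lookup p m * Poly_Mapping.lookup q m'))"
    by (simp add: sum_product mult_single)
  finally have "poly_subst g (p * q) = (\<Sum>m \<in> Poly_Mapping.keys p. \<Sum>m' \<in> Poly_Mapping.keys q.
      (Const (Poly_Mapping.lookup p m) * monom_subst g m) *
      (Const (Poly_Mapping.lookup q m') * monom_subst g m'))"
    by (simp add: poly_subst_sum poly_subst_single monom_subst_add Const_mult ac_simps)
  then show ?thesis
    by (simp add: poly_subst_eq_monom_subst sum_product)
qed

lemma poly_subst_1 [simp]: "poly_subst g 1 = 1"
  by (simp add: poly_subst_def Const_def)

lemma poly_subst_uminus: "poly_subst g (- p) = - poly_subst g p"
  using poly_subst_add [of g p "- p"] by (simp add: add_eq_0_iff)

lemma poly_subst_diff: "poly_subst g (p - q) = poly_subst g p - poly_subst g q"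
  using poly_subst_add [of g p "- q"] by (simp add: poly_subst_uminus)

lemma poly_subst_power: "poly_subst g (p ^ k) = poly_subst g p ^ k"
  by (induction k) (simp_all add: poly_subst_mult)

lemma poly_subst_prod: "poly_subst g (\<Prod>k \<in> A. p k) = (\<Prod>k \<in> A. poly_subst g (p k))"
  by (induction A rule: infinite_finite_induct) (simp_all add: poly_subst_mult)

lemma poly_subst_Var [simp]: "poly_subst g (Var k) = g k"
  by (simp add: Var_def poly_subst_single monom_subst_def) (simp add: Const_def)

lemma poly_subst_Const [simp]: "poly_subst g (Const c) = Const c"
  by (simp add: Const_def poly_subst_single monom_subst_def mult_single)

lemma poly_subst_of_int [simp]: "poly_subst g (of_int c) = of_int c"
  by (metis Const_of_int poly_subst_Const)

lemma monom_subst_Var: "monom_subst Var m = Poly_Mapping.single m 1"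
proof -
  have *: "Var k ^ i = Poly_Mapping.single (Poly_Mapping.single k i) 1" for k i
    by (induction i) (simp_all add: Var_def mult_single flip: single_add)
  have "(\<Prod>k \<in> A. Poly_Mapping.single (f k) (1::real)) = Poly_Mapping.single (\<Sum>k \<in> A. f k) 1"
    for A and f :: "nat \<Rightarrow> nat \<Rightarrow>\<^sub>0 nat"
    by (induction A rule: infinite_finite_induct) (simp_all add: mult_single)
  moreover have "(\<Sum>k \<in> Poly_Mapping.keys m. Poly_Mapping.single k (Poly_Mapping.lookup m k)) = m"
    by (rule poly_mapping_eqI) (auto simp: lookup_sum lookup_single when_def in_keys_iff)
  ultimately show ?thesis
    by (simp add: monom_subst_def *)
qed

lemma poly_subst_id: "poly_subst Var p = p"
  by (simp add: poly_subst_eq_monom_subst monom_subst_Var Const_def mult_single sum_single_lookup)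

section \<open>Congruences preserved by substitution\<close>

lemma dvd_power_diff:
  fixes d :: "'a::comm_ring_1"
  assumes "d dvd a - b"
  shows "d dvd a ^ i - b ^ i"
  using assms power_diff_sumr2 [of a i b] by (metis dvd_mult2)

lemma dvd_mult_diff:
  fixes d :: "'a::comm_ring_1"
  assumes "d dvd a - b" "d dvd a' - b'"
  shows "d dvd a * a' - b * b'"
proof -
  have "a * a' - b * b' = (a - b) * a' + b * (a' - b')"
    by (simp add: algebra_simps)
  then show ?thesis
    using assms by simp
qed

lemma dvd_prod_diff:
  fixes d :: "'a::comm_ring_1"
  assumes "\<And>k. k \<in> A \<Longrightarrow> d dvd f k - g k"
  shows "d dvd prod f A - prod g A"
  using assms by (induction A rule: infinite_finite_induct) (simp_all add: dvd_mult_diff)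

text \<open>Sums, products and powers respect congruence modulo \<open>d\<close>. This gives both
  the factor theorem for \<open>Var k - q\<close> and the divisibility conditions for the
  classes.\<close>

lemma poly_subst_cong_dvd:
  assumes "\<And>k. d dvd g k - h k"
  shows "d dvd poly_subst g p - poly_subst h p"
proof -
  have "d dvd monom_subst g m - monom_subst h m" for m
    unfolding monom_subst_def by (intro dvd_prod_diff dvd_power_diff assms)
  then show ?thesis
    unfolding poly_subst_eq_monom_subst sum_subtractf [symmetric] right_diff_distrib [symmetric]
    by (intro dvd_sum dvd_mult)
qed

lemma poly_subst_in_polys:
  assumes "\<And>k. g k \<in> polys n"
  shows "poly_subst g p \<in> polys n"
proof -
  have sum: "sum f A \<in> polys n" if "\<And>k. f k \<in> polys n" for f :: "'b \<Rightarrow> rpoly" and A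
    using that by (induction A rule: infinite_finite_induct) simp_all
  have prod: "prod f A \<in> polys n" if "\<And>k. f k \<in> polys n" for f :: "'b \<Rightarrow> rpoly" and A
    using that by (induction A rule: infinite_finite_induct) simp_all
  have pow: "q ^ i \<in> polys n" if "q \<in> polys n" for q i
    using that by (induction i) simp_all
  have "Const c \<in> polys n" for c
    by (simp add: Const_def polys_def)
  then show ?thesis
    unfolding poly_subst_def by (intro sum polys_mult prod pow assms)
qed

text \<open>A retraction of the ring in all variables onto \<open>polys n\<close>. It allows
  quotients and coefficients to be found without regard to which variables they contain.\<close>

definition truncate_vars :: "nat \<Rightarrow> rpoly \<Rightarrow> rpoly"
  where "truncate_vars n = poly_subst (\<lambda>k. if k \<in> {1..n} then Var k else 0)"

lemma Var_in_polys: "k \<in> {1..n} \<Longrightarrow> Var k \<in> polys n"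
  by (simp add: Var_def polys_def)

lemma truncate_vars_in_polys: "truncate_vars n p \<in> polys n"
  unfolding truncate_vars_def by (intro poly_subst_in_polys) (simp add: Var_in_polys)

lemma truncate_vars_ident:
  assumes "p \<in> polys n"
  shows "truncate_vars n p = p"
proof -
  have "truncate_vars n p = poly_subst Var p"
    unfolding truncate_vars_def poly_subst_def
    using assms by (intro sum.cong prod.cong refl arg_cong2 [of _ _ _ _ "(*)"]) (force simp: polys_def)
  then show ?thesis
    by (simp add: poly_subst_id)
qed

text \<open>The retraction fixes \<open>a\<close> and \<open>b\<close>, so it turns any quotient
  into one in \<open>polys n\<close>.\<close>

lemma dvd_imp_polys_quotient:
  assumes "b dvd a" "a \<in> polys n" "b \<in> polys n"
  shows "\<exists>q \<in> polys n. a = b * q"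
proof -
  obtain q where "a = b * q"
    using assms(1) by blast
  then have "a = b * truncate_vars n q"
    using assms(2,3) by (metis poly_subst_mult truncate_vars_def truncate_vars_ident)
  then show ?thesis
    using truncate_vars_in_polys by blast
qed

section \<open>Prime elements and signed variables\<close>

text \<open>
  In contrast to \<open>prime_elem\<close>, this allows 0 and units: linear independence over the polynomials and
  linear independence modulo a root are the cases $d = 0$ and $d = x_k \pm x_j$ of one statement.
\<close>

definition splits_products :: "'a::comm_ring_1 \<Rightarrow> bool"
  where "splits_products d \<longleftrightarrow> (\<forall>a b. d dvd a * b \<longrightarrow> d dvd a \<or> d dvd b)"

lemma splits_productsD: "splits_products d \<Longrightarrow> d dvd a * b \<Longrightarrow> \<not> d dvd a \<Longrightarrow> d dvd b"
  by (auto simp: splits_products_def)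

lemma splits_products_0: "splits_products (0 :: 'a::idom)"
  by (simp add: splits_products_def)

text \<open>The factor theorem. The assumption on \<open>q\<close> holds in particular when
  \<open>q\<close> is free of \<open>Var k\<close>; it makes the substitution kill
  \<open>Var k - q\<close>.\<close>

lemma dvd_Var_minus_iff:
  assumes "poly_subst (Var(k := q)) q = q"
  shows "Var k - q dvd p \<longleftrightarrow> poly_subst (Var(k := q)) p = 0"
proof
  assume "Var k - q dvd p"
  then obtain r where "p = (Var k - q) * r" ..
  then show "poly_subst (Var(k := q)) p = 0"
    using assms by (simp add: poly_subst_mult poly_subst_diff)
next
  have "Var k - q dvd poly_subst Var p - poly_subst (Var(k := q)) p"
    by (rule poly_subst_cong_dvd) simp
  moreover assume "poly_subst (Var(k := q)) p = 0"
  ultimately show "Var k - q dvd p"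
    by (simp add: poly_subst_id)
qed

text \<open>The multiples of \<open>Var k - q\<close> are the kernel of a homomorphism into an
  integral domain.\<close>

lemma splits_products_Var_minus:
  assumes "poly_subst (Var(k := q)) q = q"
  shows "splits_products (Var k - q)"
  by (auto simp: splits_products_def dvd_Var_minus_iff [OF assms] poly_subst_mult)

lemma Var_eq_iff: "Var i = Var j \<longleftrightarrow> i = j"
  by (metis lookup_Var zero_neq_one)

lemma Var_nonzero: "Var i \<noteq> 0"
  using lookup_Var[of i i] by (metis lookup_zero zero_neq_one)

lemma Var_square_eq_iff: "Var i ^ 2 = Var j ^ 2 \<longleftrightarrow> i = j"
proof
  assume "Var i ^ 2 = Var j ^ 2"
  then have "Var i = Var j \<or> Var i = - Var j"
    by (simp add: power2_eq_iff)
  moreover have "Var i \<noteq> - Var j"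
  proof
    assume "Var i = - Var j"
    from arg_cong [OF this, of "\<lambda>p. Poly_Mapping.lookup p (Poly_Mapping.single i 1)"]
    show False
      using lookup_Var [of j i] lookup_Var [of i i] by (simp split: if_splits)
  qed
  ultimately show "i = j"
    by (simp add: Var_eq_iff)
qed simp

lemma signs_dvd_iff:
  fixes \<delta> \<gamma> :: int
  assumes "\<delta> \<in> {1, -1}" "\<gamma> \<in> {1, -1}"
  shows "of_int \<delta> * x - of_int \<gamma> * y dvd z \<longleftrightarrow> x - of_int (\<delta> * \<gamma>) * y dvd (z :: 'a::comm_ring_1)"
proof -
  have "of_int \<delta> * x - of_int \<gamma> * y = of_int \<delta> * (x - of_int (\<delta> * \<gamma>) * y)"
    using assms by auto
  moreover have "of_int \<delta> * a dvd z \<longleftrightarrow> a dvd z" for a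
    using assms(1) by auto
  ultimately show ?thesis by simp
qed

text \<open>Up to sign, \<open>d\<close> is \<open>Var k\<close> minus a signed
  \<open>Var j\<close>, so divisibility by \<open>d\<close> is tested by substituting for
  \<open>Var k\<close>. The excluded pair is a true exception: \<open>d\<close> divides the
  difference of the squares of \<open>Var j\<close> and \<open>Var k\<close>. It disappears when
  \<open>k\<close> is removed from the set of variables.\<close>

lemma signed_Var_difference:
  fixes \<delta> \<gamma> :: int
  assumes "\<delta> \<in> {1, -1}" "\<gamma> \<in> {1, -1}" "k \<noteq> j"
  defines "d \<equiv> of_int \<delta> * Var k - of_int \<gamma> * Var j"
  shows splits_products_signed_Var: "splits_products d"
    and not_signed_Var_dvd_Var: "\<not> d dvd Var i"
    and not_signed_Var_dvd_squares: "a \<noteq> b \<Longrightarrow> {a, b} \<noteq> {j, k} \<Longrightarrow> \<not> d dvd Var a ^ 2 - Var b ^ 2"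
proof -
  let ?q = "of_int (\<delta> * \<gamma>) * Var j"
  have q: "poly_subst (Var(k := ?q)) ?q = ?q"
    using assms(3) unfolding poly_subst_mult poly_subst_of_int by simp
  have dvd: "d dvd p \<longleftrightarrow> Var k - ?q dvd p" for p
    unfolding d_def using assms by (intro signs_dvd_iff)
  show "splits_products d"
    using splits_products_Var_minus [OF q] by (simp only: splits_products_def dvd)
  have "?q \<noteq> 0"
    using assms Var_nonzero by auto
  then show "\<not> d dvd Var i"
    unfolding dvd dvd_Var_minus_iff [OF q] by (simp add: Var_nonzero)
  show "\<not> d dvd Var a ^ 2 - Var b ^ 2" if ab: "a \<noteq> b" "{a, b} \<noteq> {j, k}"
  proof -
    \<comment> \<open>Squaring removes the sign, so on squares the substitution merely renames
      \<open>k\<close> to \<open>j\<close>.\<close>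
    have sq: "poly_subst (Var(k := ?q)) (Var i ^ 2) = Var (if i = k then j else i) ^ 2" for i
      using assms(1,2) by (auto simp: poly_subst_power)
    have "(if a = k then j else a) \<noteq> (if b = k then j else b)"
      using ab by auto
    then show ?thesis
      unfolding dvd dvd_Var_minus_iff [OF q] poly_subst_diff sq by (simp add: Var_square_eq_iff)
  qed
qed

lemma splits_products_Var: "splits_products (Var k)"
  using splits_products_Var_minus [of k 0] by simp

section \<open>Interpolation\<close>

text \<open>Modulo \<open>d\<close>, this says that a polynomial with more distinct roots than its
  degree is zero. Splitting off one linear factor at a time avoids forming the quotient
  ring.\<close>

lemma dvd_coeff_of_dvd_values:
  fixes d :: "'a::idom" and z :: "'b \<Rightarrow> 'a"
  assumes "finite K" "splits_products d"
    and "\<And>j k. j \<in> K \<Longrightarrow> k \<in> K \<Longrightarrow> j \<noteq> k \<Longrightarrow> \<not> d dvd z j - z k"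
    and "\<And>i. i \<ge> card K \<Longrightarrow> coeff P i = 0"
    and "\<And>k. k \<in> K \<Longrightarrow> d dvd poly P (z k)"
  shows "d dvd coeff P i"
  using assms(1,3-)
proof (induction K arbitrary: P i rule: finite_induct)
  case empty
  then show ?case by simp
next
  case (insert k0 K)
  define Q where "Q = synthetic_div P (z k0)"
  have P: "[:- z k0, 1:] * Q + [:poly P (z k0):] = P"
    unfolding Q_def by (rule synthetic_div_correct')
  have Q: "d dvd coeff Q i" for i
  proof (rule insert.IH)
    fix i assume i: "card K \<le> i"
    have "degree P \<le> card K"
      using insert.prems(2) insert.hyps by (intro degree_le) auto
    then have "degree Q < i \<or> Q = 0"
      using i by (auto simp: Q_def degree_synthetic_div synthetic_div_eq_0_iff)
    then show "coeff Q i = 0"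
      by (auto simp: coeff_eq_0)
  next
    fix k assume k: "k \<in> K"
    have "poly P (z k) = (z k - z k0) * poly Q (z k) + poly P (z k0)"
      by (subst P [symmetric]) (simp add: algebra_simps)
    then have "(z k - z k0) * poly Q (z k) = poly P (z k) - poly P (z k0)"
      by simp
    then have "d dvd (z k - z k0) * poly Q (z k)"
      using insert.prems(3) k by simp
    moreover have "\<not> d dvd z k - z k0"
      using insert.prems(1) [of k k0] insert.hyps k by auto
    ultimately show "d dvd poly Q (z k)"
      using splits_productsD [OF assms(2)] by blast
  qed (use insert.prems(1) in blast)
  have c: "d dvd coeff [:poly P (z k0):] i"
    using insert.prems(3) by (cases i) auto
  have "coeff P i = coeff (pCons 0 Q) i - z k0 * coeff Q i + coeff [:poly P (z k0):] i"
    by (subst P [symmetric]) (cases i; simp add: algebra_simps)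
  moreover have "d dvd coeff (pCons 0 Q) i"
    using Q by (cases i) simp_all
  ultimately show ?case
    using c Q by simp
qed

text \<open>Newton's divided differences, without fractions: the first difference quotients
  \<open>a'\<close> satisfy the same divisibility conditions on the smaller set. The cancellation
  assumption replaces coprimality of the differences \<open>z j - z k\<close> and
  \<open>z j - z i\<close>.\<close>

lemma newton_interpolation:
  fixes z a :: "'b \<Rightarrow> 'a::idom"
  assumes "finite K"
    and "\<And>i j k c. i \<in> K \<Longrightarrow> j \<in> K \<Longrightarrow> k \<in> K \<Longrightarrow> i \<noteq> j \<Longrightarrow> i \<noteq> k \<Longrightarrow> j \<noteq> k \<Longrightarrow>
      z j - z k dvd (z j - z i) * c \<Longrightarrow> z j - z k dvd c"
    and "\<And>j k. j \<in> K \<Longrightarrow> k \<in> K \<Longrightarrow> j \<noteq> k \<Longrightarrow> z j - z k dvd a j - a k"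
  shows "\<exists>P. (\<forall>i \<ge> card K. coeff P i = 0) \<and> (\<forall>k \<in> K. poly P (z k) = a k)"
  using assms
proof (induction K arbitrary: a rule: finite_induct)
  case empty
  show ?case by (intro exI [of _ 0]) simp
next
  case (insert k0 K)
  have "\<forall>k \<in> K. \<exists>c. a k - a k0 = (z k - z k0) * c"
    using insert.prems(2) insert.hyps by (metis dvdE insertI1 insertI2)
  then obtain a' where a': "\<And>k. k \<in> K \<Longrightarrow> a k - a k0 = (z k - z k0) * a' k"
    by metis
  have "z j - z k dvd a' j - a' k" if jk: "j \<in> K" "k \<in> K" "j \<noteq> k" for j k
  proof -
    \<comment> \<open>Both terms in \<open>a\<close> and the last product are multiples of
      \<open>z j - z k\<close>; the factor \<open>z j - z k0\<close> is then cancelled.\<close>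
    have "(z j - z k0) * (a' j - a' k) = (a j - a k0) - (a k - a k0) - (z j - z k) * a' k"
      unfolding a' [OF jk(1)] a' [OF jk(2)] by (simp add: algebra_simps)
    then have "z j - z k dvd (z j - z k0) * (a' j - a' k)"
      using insert.prems(2) [of j k] jk by simp
    moreover have "k0 \<noteq> j" "k0 \<noteq> k"
      using insert.hyps jk by auto
    ultimately show ?thesis
      using insert.prems(1) [of k0 j k] jk by blast
  qed
  then have "\<exists>Q. (\<forall>i \<ge> card K. coeff Q i = 0) \<and> (\<forall>k \<in> K. poly Q (z k) = a' k)"
    by (intro insert.IH) (auto intro: insert.prems(1))
  then obtain Q where Q: "\<And>i. i \<ge> card K \<Longrightarrow> coeff Q i = 0" "\<And>k. k \<in> K \<Longrightarrow> poly Q (z k) = a' k"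
    by blast
  define P where "P = [:a k0:] + [:- z k0, 1:] * Q"
  have "coeff P i = 0" if "i \<ge> card (insert k0 K)" for i
  proof -
    obtain i' where "i = Suc i'" "card K \<le> i'"
      using \<open>i \<ge> card (insert k0 K)\<close> insert.hyps by (cases i) auto
    then show ?thesis
      by (simp add: P_def Q)
  qed
  moreover have "poly P (z k) = a k" if "k \<in> insert k0 K" for k
  proof (cases "k = k0")
    case True
    then show ?thesis by (simp add: P_def)
  next
    case False
    have "poly P (z k) = a k0 + (z k - z k0) * a' k"
      using that False by (simp add: P_def Q algebra_simps)
    also have "\<dots> = a k"
      using a' [of k] that False by (metis add.commute diff_add_cancel insertE)
    finally show ?thesis .
  qed
  ultimately show ?case by blast
qed

section \<open>Halving, and divisibility by differences of squares\<close>

lemma double_half: "2 * (Const (1 / 2) * p) = p"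
  using Const_mult [of "1 / 2" 2] Const_of_int [of 2] Const_of_int [of 1]
  by (simp flip: mult.assoc, simp add: mult.commute)

text \<open>As 2 is a unit, congruences can be split into even and odd parts.\<close>

lemma double_dvd_iff: "d dvd 2 * p \<longleftrightarrow> d dvd (p :: rpoly)"
proof
  assume "d dvd 2 * p"
  then have "d dvd Const (1 / 2) * (2 * p)"
    by (rule dvd_mult)
  then show "d dvd p"
    using double_half [of p] by (simp only: mult.left_commute)
qed simp

text \<open>The two linear factors are non-associated primes: if the sum divided the difference, it
  would divide \<open>2 * Var j\<close>.\<close>

lemma dvd_Var_squares_iff:
  assumes "j \<noteq> k"
  shows "Var j ^ 2 - Var k ^ 2 dvd p \<longleftrightarrow>
    Var j - Var k dvd p \<and> Var j + Var k dvd p"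
proof
  have sq: "Var j ^ 2 - Var k ^ 2 = (Var j - Var k) * (Var j + Var k)"
    by (simp add: power2_eq_square algebra_simps)
  show "Var j - Var k dvd p \<and> Var j + Var k dvd p" if "Var j ^ 2 - Var k ^ 2 dvd p"
    using that unfolding sq by (blast dest: dvd_mult_left dvd_mult_right)
  assume *: "Var j - Var k dvd p \<and> Var j + Var k dvd p"
  then obtain r where r: "p = (Var j - Var k) * r"
    by blast
  have "\<not> Var j + Var k dvd Var j - Var k"
  proof
    assume "Var j + Var k dvd Var j - Var k"
    then have "Var j + Var k dvd (Var j - Var k) + (Var j + Var k)"
      by (simp only: dvd_add dvd_refl)
    then have "Var j + Var k dvd Var j"
      by (simp add: double_dvd_iff flip: mult_2)
    then show False
      using not_signed_Var_dvd_Var [of 1 "-1" j k j] assms by simp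
  qed
  then have "Var j + Var k dvd r"
    using * splits_productsD [of "Var j + Var k" "Var j - Var k" r]
      splits_products_signed_Var [of 1 "-1" j k] assms by (simp add: r)
  then show "Var j ^ 2 - Var k ^ 2 dvd p"
    unfolding sq r by (rule mult_dvd_mono [OF dvd_refl])
qed

text \<open>The cancellation assumption of \<open>newton_interpolation\<close> for the nodes
  \<open>Var k ^ 2\<close>. The modulus is not prime, so its two linear factors are handled
  separately.\<close>

lemma dvd_Var_squares_cancel:
  assumes "i \<noteq> j" "i \<noteq> k" "j \<noteq> k" "Var j ^ 2 - Var k ^ 2 dvd (Var j ^ 2 - Var i ^ 2) * p"
  shows "Var j ^ 2 - Var k ^ 2 dvd p"
proof -
  have "of_int 1 * Var j - of_int \<gamma> * Var k dvd p"
    if "\<gamma> \<in> {1, -1}" "of_int 1 * Var j - of_int \<gamma> * Var k dvd (Var j ^ 2 - Var i ^ 2) * p" for \<gamma> :: int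
    using that(2)
  proof (rule splits_productsD [rotated])
    show "splits_products (of_int 1 * Var j - of_int \<gamma> * Var k)"
      using that(1) assms(3) by (intro splits_products_signed_Var) auto
    show "\<not> of_int 1 * Var j - of_int \<gamma> * Var k dvd Var j ^ 2 - Var i ^ 2"
      using that(1) assms by (intro not_signed_Var_dvd_squares) auto
  qed
  from this [of 1] this [of "-1"] show ?thesis
    using assms(4) unfolding dvd_Var_squares_iff [OF assms(3)] by simp
qed

text \<open>Distinct variables are non-associated primes: setting one of them to 0 leaves the
  product of the others unchanged, hence nonzero.\<close>

lemma prod_Var_dvd:
  assumes "finite K" "\<And>k. k \<in> K \<Longrightarrow> Var k dvd p"
  shows "(\<Prod>k \<in> K. Var k) dvd p"
  using assms
proof (induction K rule: finite_induct)
  case (insert k K)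
  then obtain r where r: "p = (\<Prod>k \<in> K. Var k) * r"
    by (meson dvdE insertI2)
  have "\<not> Var k dvd (\<Prod>k \<in> K. Var k)"
  proof
    have "(\<Prod>i \<in> K. (Var(k := 0)) i) = (\<Prod>i \<in> K. Var i)"
      using insert.hyps by (intro prod.cong) auto
    moreover assume "Var k dvd (\<Prod>k \<in> K. Var k)"
    ultimately show False
      using dvd_Var_minus_iff [of k 0 "\<Prod>k \<in> K. Var k"] insert.hyps
      by (simp add: poly_subst_prod Var_nonzero)
  qed
  then have "Var k dvd r"
    using insert.prems r splits_productsD [OF splits_products_Var] by blast
  then show ?case
    using insert.hyps by (simp add: r mult.commute mult_dvd_mono)
qed simp

lemma coeff_sum_monom: "coeff (\<Sum>i<N. monom (c i) i) j = (if j < N then c j else 0)"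
  by (simp add: coeff_sum)

lemma poly_sum_monom: "poly (\<Sum>i<N. monom (c i) i) z = (\<Sum>i<N. c i * z ^ i :: 'a::comm_semiring_1)"
  by (simp add: poly_sum poly_monom)

lemma poly_eq_sum_of_coeff_eq_0:
  fixes P :: "'a::comm_semiring_1 poly"
  assumes "\<And>i. i \<ge> N \<Longrightarrow> coeff P i = 0"
  shows "poly P z = (\<Sum>i<N. coeff P i * z ^ i)"
proof -
  have P: "(\<Sum>i<N. monom (coeff P i) i) = P"
    using assms by (intro poly_eqI) (auto simp: coeff_sum_monom)
  show ?thesis
    using poly_sum_monom [of "coeff P" N z] unfolding P .
qed

lemma sum_power_even_odd:
  fixes x :: "'a::comm_semiring_1"
  shows "(\<Sum>i\<le>2 * l. b i * x ^ i) =
    (\<Sum>i<Suc l. b (2 * i) * (x ^ 2) ^ i) + x * (\<Sum>i<l. b (2 * i + 1) * (x ^ 2) ^ i)"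
proof (induction l)
  case (Suc l)
  have "(\<Sum>i\<le>2 * Suc l. b i * x ^ i) =
      (\<Sum>i\<le>2 * l. b i * x ^ i) + (b (2 * l + 1) * (x * (x ^ 2) ^ l) + b (2 * Suc l) * (x ^ 2) ^ Suc l)"
    by (simp add: power2_eq_square power_mult_distrib mult_2 power_add mult.assoc add.assoc)
  then show ?case
    unfolding Suc by (simp add: distrib_left ac_simps)
qed simp

section \<open>Functions on the vertices $\pm x_k$\<close>

text \<open>Adding and subtracting the values at the two signs separates even and odd exponents.
  After multiplying the odd part by \<open>Var k\<close>, both become polynomials in
  \<open>Var k ^ 2\<close> with \<open>Suc l\<close> coefficients, as many as there are
  nodes.\<close>

lemma vertex_independence:
  assumes K: "finite K" "card K = Suc l" and d: "splits_products d"
    and nV: "\<And>k. k \<in> K \<Longrightarrow> \<not> d dvd Var k"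
    and nS: "\<And>j k. j \<in> K \<Longrightarrow> k \<in> K \<Longrightarrow> j \<noteq> k \<Longrightarrow> \<not> d dvd Var j ^ 2 - Var k ^ 2"
    and dvd: "\<And>k \<delta>. k \<in> K \<Longrightarrow> \<delta> \<in> {1, -1 :: int} \<Longrightarrow>
      d dvd (\<Sum>i\<le>2 * l. b i * (of_int \<delta> * Var k) ^ i) + b' * (of_int \<delta> * (\<Prod>j \<in> K - {k}. Var j))"
  shows "d dvd b'" and "i \<le> 2 * l \<Longrightarrow> d dvd b i"
proof -
  define ev od where "ev = (\<lambda>z. \<Sum>i<Suc l. b (2 * i) * z ^ i)"
    and "od = (\<lambda>z. \<Sum>i<l. b (2 * i + 1) * z ^ i)"
  define P where "P = (\<Sum>i<Suc l. monom (b (2 * i)) i)"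
  \<comment> \<open>Multiplication by \<open>Var k\<close> completes the product over
    \<open>K - {k}\<close> to the product over \<open>K\<close>. This no longer depends on
    \<open>k\<close> and can serve as a constant term.\<close>
  define Q where "Q = pCons (b' * (\<Prod>j \<in> K. Var j)) (\<Sum>i<l. monom (b (2 * i + 1)) i)"
  have val: "d dvd ev (Var k ^ 2)" "d dvd poly Q (Var k ^ 2)" if k: "k \<in> K" for k
  proof -
    let ?E = "ev (Var k ^ 2)" and ?O = "Var k * od (Var k ^ 2) + b' * (\<Prod>j \<in> K - {k}. Var j)"
    have p: "d dvd ?E + ?O"
      using dvd [OF k, of 1] unfolding sum_power_even_odd ev_def od_def by (simp add: ac_simps)
    have m: "d dvd ?E - ?O"
      using dvd [OF k, of "-1"] unfolding sum_power_even_odd ev_def od_def by (simp add: algebra_simps)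
    from p m show "d dvd ?E"
      using dvd_add [OF p m] by (simp add: double_dvd_iff flip: mult_2)
    have "?E + ?O - (?E - ?O) = 2 * ?O"
      by (simp only: mult_2) simp
    then have "d dvd ?O"
      using dvd_diff [OF p m] by (simp only: double_dvd_iff)
    then have "d dvd Var k * ?O"
      by (rule dvd_mult)
    moreover have "(\<Prod>j \<in> K. Var j) = Var k * (\<Prod>j \<in> K - {k}. Var j)"
      using K(1) k by (rule prod.remove)
    then have "Var k * ?O = poly Q (Var k ^ 2)"
      by (simp add: Q_def poly_sum_monom od_def power2_eq_square algebra_simps)
    ultimately show "d dvd poly Q (Var k ^ 2)"
      by simp
  qed
  have P: "d dvd coeff P i" for i
    by (rule dvd_coeff_of_dvd_values [OF K(1) d nS])
      (use val(1) in \<open>simp_all add: P_def K(2) coeff_sum_monom poly_sum_monom ev_def del: sum.lessThan_Suc\<close>)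
  have Q: "d dvd coeff Q i" for i
    by (rule dvd_coeff_of_dvd_values [OF K(1) d nS])
      (use val(2) in \<open>simp_all add: Q_def K(2) coeff_sum_monom coeff_pCons split: nat.split\<close>)
  have "\<not> d dvd (\<Prod>j \<in> K. Var j)"
    using K(1) nV
  proof (induction K rule: finite_induct)
    case empty
    \<comment> \<open>A unit \<open>d\<close> would divide the variables of the original set, which
      is nonempty.\<close>
    have "d dvd 1 \<Longrightarrow> d dvd p" for p
      using dvd_trans one_dvd by blast
    moreover obtain k where "k \<in> K"
      using K(2) by fastforce
    ultimately show ?case
      using assms(4) by auto
  next
    case (insert k K)
    then show ?case
      using splits_productsD [OF d, of "Var k" "\<Prod>j \<in> K. Var j"] by auto
  qed
  then show "d dvd b'"
    using Q [of 0] splits_productsD [OF d, of "\<Prod>j \<in> K. Var j" b'] by (simp add: Q_def mult.commute)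
  show "d dvd b i" if "i \<le> 2 * l"
  proof (cases "even i")
    case True
    then show ?thesis
      using P [of "i div 2"] that by (auto simp: P_def coeff_sum_monom split: if_splits)
  next
    case False
    then obtain i' where "i = 2 * i' + 1"
      by (rule oddE)
    then show ?thesis
      using Q [of "Suc i'"] that by (auto simp: Q_def coeff_sum_monom split: if_splits)
  qed
qed

lemma vertex_interpolation:
  assumes K: "finite K" "card K = Suc l"
    and dvd: "\<And>j k \<delta> \<gamma>. j \<in> K \<Longrightarrow> k \<in> K \<Longrightarrow> j \<noteq> k \<Longrightarrow> \<delta> \<in> {1, -1 :: int} \<Longrightarrow> \<gamma> \<in> {1, -1} \<Longrightarrow>
      of_int \<delta> * Var j - of_int \<gamma> * Var k dvd \<alpha> j \<delta> - \<alpha> k \<gamma>"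
  shows "\<exists>b b'. \<forall>k \<in> K. \<forall>\<delta> \<in> {1, -1}. \<alpha> k \<delta> =
    (\<Sum>i\<le>2 * l. b i * (of_int \<delta> * Var k) ^ i) + b' * (of_int \<delta> * (\<Prod>j \<in> K - {k}. Var j))"
proof -
  define g h where "g = (\<lambda>k. Const (1 / 2) * (\<alpha> k 1 + \<alpha> k (-1)))"
    and "h = (\<lambda>k. Const (1 / 2) * (\<alpha> k 1 - \<alpha> k (-1)))"
  have g: "2 * g k = \<alpha> k 1 + \<alpha> k (-1)" and h: "2 * h k = \<alpha> k 1 - \<alpha> k (-1)" for k
    by (simp_all add: g_def h_def double_half)
  have \<alpha>: "\<alpha> k \<delta> = g k + of_int \<delta> * h k" if "\<delta> \<in> {1, -1}" for k \<delta>
  proof -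
    have "2 * \<alpha> k \<delta> = 2 * (g k + of_int \<delta> * h k)"
      using that g [of k] h [of k] by (auto simp: algebra_simps)
    then show ?thesis
      by (metis mult_cancel_left zero_neq_numeral)
  qed
  have gh: "Var j ^ 2 - Var k ^ 2 dvd g j - g k" "Var j ^ 2 - Var k ^ 2 dvd Var j * h j - Var k * h k"
    if jk: "j \<in> K" "k \<in> K" "j \<noteq> k" for j k
  proof -
    have m: "Var j - Var k dvd \<alpha> j 1 - \<alpha> k 1" "Var j - Var k dvd \<alpha> j (-1) - \<alpha> k (-1)"
      and p: "Var j + Var k dvd \<alpha> j 1 - \<alpha> k (-1)" "Var j + Var k dvd \<alpha> j (-1) - \<alpha> k 1"
      using dvd [OF jk, of 1 1] dvd [OF jk, of 1 "-1"] dvd [OF jk, of "-1" 1] dvd [OF jk, of "-1" "-1"]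
      by (simp_all add: signs_dvd_iff [of "-1" "-1", simplified] signs_dvd_iff [of "-1" 1, simplified] add.commute)
    have G: "2 * (g j - g k) = (\<alpha> j 1 - \<alpha> k 1) + (\<alpha> j (-1) - \<alpha> k (-1))"
      "2 * (g j - g k) = (\<alpha> j 1 - \<alpha> k (-1)) + (\<alpha> j (-1) - \<alpha> k 1)"
      using g [of j] g [of k] by (simp_all add: algebra_simps)
    have "Var j - Var k dvd 2 * (g j - g k)" "Var j + Var k dvd 2 * (g j - g k)"
      using dvd_add [OF m] dvd_add [OF p] unfolding G(1) [symmetric] G(2) [symmetric] .
    then show "Var j ^ 2 - Var k ^ 2 dvd g j - g k"
      by (simp only: double_dvd_iff dvd_Var_squares_iff [OF jk(3)] simp_thms)
    have H: "2 * (h j - h k) = (\<alpha> j 1 - \<alpha> k 1) - (\<alpha> j (-1) - \<alpha> k (-1))"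
      "2 * (h j + h k) = (\<alpha> j 1 - \<alpha> k (-1)) - (\<alpha> j (-1) - \<alpha> k 1)"
      using h [of j] h [of k] by (simp_all add: algebra_simps)
    have "Var j - Var k dvd 2 * (h j - h k)" "Var j + Var k dvd 2 * (h j + h k)"
      using dvd_diff [OF m] dvd_diff [OF p] unfolding H(1) [symmetric] H(2) [symmetric] .
    then have H': "Var j - Var k dvd h j - h k" "Var j + Var k dvd h j + h k"
      by (simp_all only: double_dvd_iff)
    \<comment> \<open>One decomposition for each linear factor: \<open>h j\<close> and
      \<open>h k\<close> agree modulo \<open>Var j - Var k\<close> but are opposite modulo
      \<open>Var j + Var k\<close>. Multiplication by the variable makes up for this sign.\<close>
    have e: "Var j * h j - Var k * h k = Var j * (h j - h k) + (Var j - Var k) * h k"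
      "Var j * h j - Var k * h k = (Var j + Var k) * h j - Var k * (h j + h k)"
      by (simp_all add: algebra_simps)
    have "Var j - Var k dvd Var j * h j - Var k * h k"
      unfolding e(1) using H'(1) by simp
    moreover have "Var j + Var k dvd Var j * h j - Var k * h k"
      unfolding e(2) using H'(2) by (intro dvd_diff dvd_triv_left dvd_mult)
    ultimately show "Var j ^ 2 - Var k ^ 2 dvd Var j * h j - Var k * h k"
      by (simp add: dvd_Var_squares_iff [OF jk(3)])
  qed
  have "\<exists>P. (\<forall>i \<ge> card K. coeff P i = 0) \<and> (\<forall>k \<in> K. poly P (Var k ^ 2) = g k)"
    by (rule newton_interpolation [OF K(1)]) (rule dvd_Var_squares_cancel gh(1); assumption)+
  then obtain P where P: "\<And>i. i \<ge> Suc l \<Longrightarrow> coeff P i = 0" "\<And>k. k \<in> K \<Longrightarrow> poly P (Var k ^ 2) = g k"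
    unfolding K(2) by blast
  have "\<exists>Q. (\<forall>i \<ge> card K. coeff Q i = 0) \<and> (\<forall>k \<in> K. poly Q (Var k ^ 2) = Var k * h k)"
    by (rule newton_interpolation [OF K(1)]) (rule dvd_Var_squares_cancel gh(2); assumption)+
  then obtain Q where Q: "\<And>i. i \<ge> Suc l \<Longrightarrow> coeff Q i = 0" "\<And>k. k \<in> K \<Longrightarrow> poly Q (Var k ^ 2) = Var k * h k"
    unfolding K(2) by blast
  obtain c Q' where Q': "Q = pCons c Q'"
    by (cases Q)
  have Q'0: "coeff Q' i = 0" if "i \<ge> l" for i
    using Q(1) [of "Suc i"] that by (simp add: Q')
  have c: "c = Var k * (h k - Var k * poly Q' (Var k ^ 2))" if "k \<in> K" for k
    using Q(2) [OF that] by (simp add: Q' power2_eq_square algebra_simps)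
  \<comment> \<open>At the node \<open>Var k ^ 2\<close> both the value of \<open>Q\<close> and its
    non-constant terms are multiples of \<open>Var k\<close>.\<close>
  have "(\<Prod>k \<in> K. Var k) dvd c"
  proof (rule prod_Var_dvd [OF K(1)])
    show "Var k dvd c" if "k \<in> K" for k
      using c [OF that] by (metis dvd_triv_left)
  qed
  then obtain b' where b': "c = (\<Prod>k \<in> K. Var k) * b'" ..
  \<comment> \<open>Dividing \<open>Q\<close> by \<open>Var k\<close> turns the coefficient of index
    \<open>i\<close> in \<open>Q'\<close> into that of the odd power
    \<open>2 * i + 1\<close>.\<close>
  define b where "b = (\<lambda>i. if even i then coeff P (i div 2) else coeff Q' (i div 2))"
  have "\<alpha> k \<delta> =
      (\<Sum>i\<le>2 * l. b i * (of_int \<delta> * Var k) ^ i) + b' * (of_int \<delta> * (\<Prod>j \<in> K - {k}. Var j))"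
    if k: "k \<in> K" and \<delta>: "\<delta> \<in> {1, -1}" for k \<delta>
  proof -
    have "Var k * (h k - Var k * poly Q' (Var k ^ 2)) = Var k * ((\<Prod>j \<in> K - {k}. Var j) * b')"
      using c [OF k] b' prod.remove [OF K(1) k, of Var] by (simp only: mult.assoc)
    then have "h k - Var k * poly Q' (Var k ^ 2) = (\<Prod>j \<in> K - {k}. Var j) * b'"
      by (simp only: mult_cancel_left Var_nonzero simp_thms)
    then have h: "h k = Var k * poly Q' (Var k ^ 2) + b' * (\<Prod>j \<in> K - {k}. Var j)"
      by (simp add: algebra_simps)
    have sq: "(of_int \<delta> * Var k) ^ 2 = Var k ^ 2"
      using \<delta> by (auto simp: power2_eq_square)
    have "(\<Sum>i\<le>2 * l. b i * (of_int \<delta> * Var k) ^ i) = g k + of_int \<delta> * (Var k * poly Q' (Var k ^ 2))"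
      using poly_eq_sum_of_coeff_eq_0 [of "Suc l" P "Var k ^ 2"] P(1)
        poly_eq_sum_of_coeff_eq_0 [of l Q' "Var k ^ 2"] Q'0
      unfolding sum_power_even_odd sq P(2) [OF k, symmetric] by (simp add: b_def mult.assoc)
    then show ?thesis
      unfolding \<alpha> [OF \<delta>] h by (simp add: algebra_simps)
  qed
  then show ?thesis by blast
qed

section \<open>Signed orderings of the variables\<close>

text \<open>
  A group element $w = (u, \epsilon)$ is encoded by the list of the pairs $(u(k), \epsilon_k)$, that is,
  by the sequence $w x_1, \dots, w x_n$. The sublists starting at position $r + 1$ are the elements
  of a coset of the stabiliser of $x_1, \dots, x_r$.
\<close>

definition signed_orderings :: "int \<Rightarrow> nat set \<Rightarrow> (nat \<times> int) list set"
  where "signed_orderings s K = {t. distinct (map fst t) \<and> fst ` set t = K \<and>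
    snd ` set t \<subseteq> {1, -1} \<and> prod_list (map snd t) = s}"

fun signed_var :: "nat \<times> int \<Rightarrow> rpoly"
  where "signed_var (k, \<delta>) = of_int \<delta> * Var k"

definition monomial_at :: "(nat \<times> int) list \<Rightarrow> nat list \<Rightarrow> rpoly"
  where "monomial_at t I = prod_list (map2 (\<lambda>p i. signed_var p ^ i) t I)"

text \<open>The fibre over a vertex. Since a sign is its own inverse, the remaining signs multiply
  to \<open>s * \<delta>\<close>.\<close>

lemma signed_orderings_Cons:
  "(k, \<delta>) # t \<in> signed_orderings s K \<longleftrightarrow>
    k \<in> K \<and> \<delta> \<in> {1, -1} \<and> t \<in> signed_orderings (s * \<delta>) (K - {k})"
proof -
  have "\<delta> * prod_list (map snd t) = s \<longleftrightarrow> prod_list (map snd t) = s * \<delta>" if "\<delta> = 1 \<or> \<delta> = -1"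
    using that by auto
  then show ?thesis
    by (auto simp: signed_orderings_def)
qed

lemma length_signed_orderings:
  assumes "t \<in> signed_orderings s K"
  shows "length t = card K"
  using assms distinct_card [of "map fst t"] by (simp add: signed_orderings_def)

lemma signed_orderings_singleton:
  assumes "t \<in> signed_orderings s {k}"
  shows "t = [(k, s)]"
proof -
  have "length t = 1"
    using length_signed_orderings [OF assms] by simp
  then obtain p where "t = [p]"
    by (metis One_nat_def length_0_conv length_Suc_conv)
  then show ?thesis
    using assms by (cases p) (simp add: signed_orderings_def)
qed

text \<open>The product is constant on each fibre. This is what makes x_1...x_n/p a function of the
  vertex p alone.\<close>

lemma prod_list_signed_var:
  assumes "t \<in> signed_orderings s K"
  shows "prod_list (map signed_var t) = of_int s * (\<Prod>k \<in> K. Var k)"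
proof -
  have "prod_list (map signed_var t) = of_int (prod_list (map snd t)) * prod_list (map Var (map fst t))" for t
    by (induction t) (auto simp: algebra_simps)
  moreover have "prod_list (map Var (map fst t)) = prod Var (set (map fst t))"
    using assms by (intro prod.distinct_set_conv_list [symmetric]) (simp add: signed_orderings_def)
  ultimately show ?thesis
    using assms by (simp add: signed_orderings_def)
qed

text \<open>Used to pass from the fibre over one vertex to the fibre over another: the variable of
  the old vertex takes the place of the new one.\<close>

lemma signed_orderings_replace:
  assumes "t \<in> signed_orderings s K" "i < length t" "k \<notin> K" "\<delta> \<in> {1, -1}"
  shows "t[i := (k, \<delta>)] \<in> signed_orderings (s * snd (t ! i) * \<delta>) (insert k (K - {fst (t ! i)}))"
  using assms
proof (induction t arbitrary: s K i)
  case (Cons p t)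
  obtain j \<gamma> where p: "p = (j, \<gamma>)"
    by (cases p)
  have t: "j \<in> K" "\<gamma> \<in> {1, -1}" "t \<in> signed_orderings (s * \<gamma>) (K - {j})"
    using Cons.prems(1) by (simp_all add: p signed_orderings_Cons)
  show ?case
  proof (cases i)
    case 0
    have "insert k (K - {j}) - {k} = K - {j}"
      using Cons.prems(3) by auto
    then show ?thesis
      using t Cons.prems by (auto simp: 0 p signed_orderings_Cons mult.assoc)
  next
    case (Suc i')
    have i': "i' < length t"
      using Cons.prems(2) Suc by simp
    have "fst (t ! i') \<in> K - {j}"
      using t(3) i' by (auto simp: signed_orderings_def)
    then have "insert k (K - {fst (t ! i')}) - {j} = insert k (K - {j} - {fst (t ! i')})"
      using t(1) Cons.prems(3) by auto
    moreover have "s * \<gamma> * snd (t ! i') * \<delta> = s * snd (t ! i') * \<delta> * \<gamma>"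
      by simp
    ultimately show ?thesis
      using Cons.IH [OF t(3) i'] Cons.prems(3,4) t(1,2) \<open>fst (t ! i') \<in> K - {j}\<close>
      by (simp add: Suc p signed_orderings_Cons ac_simps)
  qed
qed simp

section \<open>Monomials evaluated along orderings, and their indices\<close>

lemma monomial_at_Cons [simp]: "monomial_at (p # t) (i # I) = signed_var p ^ i * monomial_at t I"
  by (simp add: monomial_at_def)

lemma monomial_at_map_Suc:
  "length t = length I \<Longrightarrow> monomial_at t (map Suc I) = prod_list (map signed_var t) * monomial_at t I"
  by (induction t I rule: list_induct2) (simp_all add: monomial_at_def algebra_simps)

lemma monomial_at_update_dvd:
  assumes "d dvd signed_var p - signed_var (t ! i)"
  shows "d dvd monomial_at (t[i := p]) I - monomial_at t I"
  using assms
proof (induction t arbitrary: i I)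
  case (Cons q t)
  show ?case
  proof (cases I)
    case Nil
    then show ?thesis by (simp add: monomial_at_def)
  next
    case (Cons j I')
    show ?thesis
    proof (cases i)
      case 0
      then show ?thesis
        using Cons.prems by (auto simp: Cons intro!: dvd_mult_diff dvd_power_diff)
    next
      case (Suc i')
      then show ?thesis
        using Cons.prems Cons.IH [of i' I'] by (auto simp: Cons intro!: dvd_mult_diff)
    qed
  qed
qed simp

text \<open>
  The index set $\mathcal{D}_{l+1}$. Its recursion makes sense already from $\mathcal{D}_1 = \{[0]\}$
  on, which leads to a trivial base case.
\<close>

fun indices :: "nat \<Rightarrow> nat list set"
  where
    "indices 0 = {[0]}"
  | "indices (Suc l) =
      (\<lambda>(J, i). i # J) ` (indices l \<times> {..2 * Suc l}) \<union> (\<lambda>J. 0 # map Suc J) ` indices l"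

lemma D_indices_eq_indices: "D_indices (Suc (Suc l)) = indices (Suc l)"
proof (induction l)
  case 0
  have "{..2::nat} = {0, 1, 2}"
    by auto
  then show ?case by (auto simp: numeral_2_eq_2)
next
  case (Suc l)
  have "2 * (l + 3) - 2 = 2 * Suc (Suc l)"
    by simp
  then show ?case
    unfolding D_indices.simps(4) Suc indices.simps(2) [of "Suc l"] by (auto simp del: indices.simps)
qed

lemma finite_indices [simp]: "finite (indices l)"
  by (induction l) simp_all

lemma length_indices: "I \<in> indices l \<Longrightarrow> length I = Suc l"
  by (induction l arbitrary: I) auto

text \<open>This separates the two families in the recursion: the tail contains 0 for
  \<open>i # J\<close> but not for \<open>0 # map Suc J\<close>.\<close>

lemma zero_in_indices: "I \<in> indices l \<Longrightarrow> 0 \<in> set I"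
  by (induction l arbitrary: I) auto

lemma sum_indices_Suc:
  "(\<Sum>I \<in> indices (Suc l). F I) =
    (\<Sum>J \<in> indices l. (\<Sum>i\<le>2 * Suc l. F (i # J)) + F (0 # map Suc J))"
proof -
  have "inj_on (\<lambda>(J, i). i # J) (indices l \<times> {..2 * Suc l})" "inj_on (\<lambda>J. 0 # map Suc J) (indices l)"
    by (auto simp: inj_on_def)
  moreover have "(\<lambda>(J, i). i # J) ` (indices l \<times> {..2 * Suc l}) \<inter> (\<lambda>J. 0 # map Suc J) ` indices l = {}"
    by (auto dest: zero_in_indices)
  ultimately have "(\<Sum>I \<in> indices (Suc l). F I) =
      (\<Sum>(J, i) \<in> indices l \<times> {..2 * Suc l}. F (i # J)) + (\<Sum>J \<in> indices l. F (0 # map Suc J))"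
    unfolding indices.simps
    by (subst sum.union_disjoint) (simp_all add: sum.reindex case_prod_unfold)
  then show ?thesis
    by (simp add: sum.cartesian_product [symmetric] sum.distrib)
qed

text \<open>Collecting the terms by \<open>J\<close> yields, as coefficient of each smaller
  monomial, a combination of the vertex functions. The product of the variables of the fibre carries
  the sign \<open>s * \<delta>\<close>; the part \<open>s\<close> is attached to the coefficient,
  leaving the form used for vertex functions.\<close>

lemma sum_indices_monomial_at_Cons:
  assumes t: "t \<in> signed_orderings (s * \<delta>) (K - {k})" and K: "card (K - {k}) = Suc l"
  shows "(\<Sum>I \<in> indices (Suc l). a I * monomial_at ((k, \<delta>) # t) I) =
    (\<Sum>J \<in> indices l. ((\<Sum>i\<le>2 * Suc l. a (i # J) * (of_int \<delta> * Var k) ^ i) +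
      a (0 # map Suc J) * of_int s * (of_int \<delta> * (\<Prod>j \<in> K - {k}. Var j))) * monomial_at t J)"
  unfolding sum_indices_Suc
proof (rule sum.cong [OF refl])
  fix J assume "J \<in> indices l"
  then have "length t = length J"
    using length_signed_orderings [OF t] K by (simp add: length_indices)
  then show "(\<Sum>i\<le>2 * Suc l. a (i # J) * monomial_at ((k, \<delta>) # t) (i # J)) +
      a (0 # map Suc J) * monomial_at ((k, \<delta>) # t) (0 # map Suc J) =
    ((\<Sum>i\<le>2 * Suc l. a (i # J) * (of_int \<delta> * Var k) ^ i) +
      a (0 # map Suc J) * of_int s * (of_int \<delta> * (\<Prod>j \<in> K - {k}. Var j))) * monomial_at t J"
    unfolding distrib_right sum_distrib_right
    by (simp add: monomial_at_map_Suc prod_list_signed_var [OF t] mult.assoc)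
qed

text \<open>For each vertex the induction hypothesis makes the collected coefficients divisible by
  \<open>d\<close>. For fixed \<open>J\<close> these are the values of one function on all vertices,
  to which \<open>vertex_independence\<close> applies. The induction needs all \<open>s\<close> and
  all \<open>K\<close>.\<close>

lemma monomials_independent:
  assumes "finite K" "card K = Suc l" "s \<in> {1, -1}" "splits_products d"
    and "\<And>k. k \<in> K \<Longrightarrow> \<not> d dvd Var k"
    and "\<And>j k. j \<in> K \<Longrightarrow> k \<in> K \<Longrightarrow> j \<noteq> k \<Longrightarrow> \<not> d dvd Var j ^ 2 - Var k ^ 2"
    and "\<And>t. t \<in> signed_orderings s K \<Longrightarrow> d dvd (\<Sum>I \<in> indices l. a I * monomial_at t I)"
    and "I \<in> indices l"
  shows "d dvd a I"
  using assms
proof (induction l arbitrary: K s a I)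
  case 0
  then obtain k where "K = {k}"
    by (metis One_nat_def card_1_singletonE)
  then have "[(k, s)] \<in> signed_orderings s K"
    using 0 by (simp add: signed_orderings_def)
  from 0(7) [OF this] show ?case
    using 0(8) by (simp add: monomial_at_def)
next
  case (Suc l)
  define A where "A k \<delta> J = (\<Sum>i\<le>2 * Suc l. a (i # J) * (of_int \<delta> * Var k) ^ i) +
      a (0 # map Suc J) * of_int s * (of_int \<delta> * (\<Prod>j \<in> K - {k}. Var j))" for k and \<delta> :: int and J
  have A: "d dvd A k \<delta> J" if J: "J \<in> indices l" and k: "k \<in> K" and \<delta>: "\<delta> \<in> {1, -1}" for k \<delta> J
  proof (rule Suc.IH [of "K - {k}" "s * \<delta>" "A k \<delta>"])
    show card: "card (K - {k}) = Suc l"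
      using Suc.prems(1,2) k by simp
    show "s * \<delta> \<in> {1, -1}"
      using Suc.prems(3) \<delta> by auto
    fix t assume t: "t \<in> signed_orderings (s * \<delta>) (K - {k})"
    then have "(k, \<delta>) # t \<in> signed_orderings s K"
      using k \<delta> by (simp add: signed_orderings_Cons)
    from Suc.prems(7) [OF this] show "d dvd (\<Sum>J \<in> indices l. A k \<delta> J * monomial_at t J)"
      unfolding sum_indices_monomial_at_Cons [OF t card] A_def .
  qed (use Suc.prems J in auto)
  have "d dvd a (0 # map Suc J) * of_int s" "i \<le> 2 * Suc l \<Longrightarrow> d dvd a (i # J)" if J: "J \<in> indices l" for i J
    using vertex_independence [OF Suc.prems(1,2,4,5,6), of "\<lambda>i. a (i # J)" "a (0 # map Suc J) * of_int s"]
      A [OF J] unfolding A_def by blast+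
  moreover have "d dvd p * of_int s \<longleftrightarrow> d dvd p" for p
    using Suc.prems(3) by auto
  ultimately show ?case
    using Suc.prems(8) by auto
qed

text \<open>The effect on w x_1, ..., w x_n of multiplying w on the right by a reflection. Positions
  start at 0; \<open>\<eta> = 1\<close> belongs to the difference and \<open>\<eta> = -1\<close> to
  the sum of the two variables.\<close>

definition reflect :: "(nat \<times> int) list \<Rightarrow> nat \<Rightarrow> nat \<Rightarrow> int \<Rightarrow> (nat \<times> int) list"
  where "reflect t i j \<eta> =
    t[i := (fst (t ! j), \<eta> * snd (t ! j)), j := (fst (t ! i), \<eta> * snd (t ! i))]"

definition gkm_on :: "(nat \<times> int) list set \<Rightarrow> ((nat \<times> int) list \<Rightarrow> rpoly) \<Rightarrow> bool"
  where "gkm_on T f \<longleftrightarrow> (\<forall>t \<in> T. \<forall>i j. \<forall>\<eta> \<in> {1, -1}. i < j \<longrightarrow> j < length t \<longrightarrow>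
    signed_var (t ! i) - of_int \<eta> * signed_var (t ! j) dvd f (reflect t i j \<eta>) - f t)"

text \<open>Reflections that leave the first position alone preserve the fibre; the positions shift
  by one.\<close>

lemma gkm_on_Cons:
  assumes "gkm_on (signed_orderings s K) f" "k \<in> K" "\<delta> \<in> {1, -1}"
  shows "gkm_on (signed_orderings (s * \<delta>) (K - {k})) (\<lambda>t. f ((k, \<delta>) # t))"
  unfolding gkm_on_def
proof (intro ballI allI impI)
  fix t i j and \<eta> :: int
  assume t: "t \<in> signed_orderings (s * \<delta>) (K - {k})" and \<eta>: "\<eta> \<in> {1, -1}" and ij: "i < j" "j < length t"
  have "(k, \<delta>) # t \<in> signed_orderings s K"
    using t assms(2,3) by (simp add: signed_orderings_Cons)
  then have "signed_var (((k, \<delta>) # t) ! Suc i) - of_int \<eta> * signed_var (((k, \<delta>) # t) ! Suc j) dvd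
      f (reflect ((k, \<delta>) # t) (Suc i) (Suc j) \<eta>) - f ((k, \<delta>) # t)"
    using assms(1) \<eta> ij unfolding gkm_on_def by (metis Suc_less_eq length_Cons)
  then show "signed_var (t ! i) - of_int \<eta> * signed_var (t ! j) dvd
      f ((k, \<delta>) # reflect t i j \<eta>) - f ((k, \<delta>) # t)"
    by (simp add: reflect_def)
qed

text \<open>Every ordering over one vertex is reflected to an ordering over the other, and the two
  expansions are compared modulo the root. Independence modulo the root may be used because the
  variables left over do not include \<open>Var k\<close>.\<close>

lemma coefficients_vertex_condition:
  assumes K: "finite K" "card K = Suc (Suc l)" and s: "s \<in> {1, -1}"
    and f: "gkm_on (signed_orderings s K) f"
    and \<alpha>: "\<And>k \<delta> t. k \<in> K \<Longrightarrow> \<delta> \<in> {1, -1} \<Longrightarrow> t \<in> signed_orderings (s * \<delta>) (K - {k}) \<Longrightarrow>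
      f ((k, \<delta>) # t) = (\<Sum>J \<in> indices l. \<alpha> J k \<delta> * monomial_at t J)"
    and jk: "j \<in> K" "k \<in> K" "j \<noteq> k" and signs: "\<delta> \<in> {1, -1}" "\<gamma> \<in> {1, -1}"
    and J: "J \<in> indices l"
  shows "of_int \<delta> * Var k - of_int \<gamma> * Var j dvd \<alpha> J k \<delta> - \<alpha> J j \<gamma>"
proof (rule monomials_independent [of "K - {k}" l "s * \<delta>"])
  let ?d = "of_int \<delta> * Var k - of_int \<gamma> * Var j"
  show "splits_products ?d" "\<And>i. i \<in> K - {k} \<Longrightarrow> \<not> ?d dvd Var i"
    using splits_products_signed_Var [OF signs] not_signed_Var_dvd_Var [OF signs] jk(3) by metis+
  show "\<not> ?d dvd Var a ^ 2 - Var b ^ 2" if "a \<in> K - {k}" "b \<in> K - {k}" "a \<noteq> b" for a b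
    using that jk(3) by (intro not_signed_Var_dvd_squares [OF signs]) auto
  fix t assume t: "t \<in> signed_orderings (s * \<delta>) (K - {k})"
  then have "j \<in> fst ` set t"
    using jk by (simp add: signed_orderings_def)
  then obtain i \<rho> where i: "i < length t" "t ! i = (j, \<rho>)"
    by (auto simp: in_set_conv_nth)
  have "\<rho> \<in> snd ` set t"
    using i nth_mem by force
  then have \<rho>: "\<rho> \<in> {1, -1}"
    using t by (auto simp: signed_orderings_def)
  \<comment> \<open>The sign for which the reflection moves \<open>j\<close> to the front with sign
    \<open>\<gamma>\<close>.\<close>
  define \<eta> where "\<eta> = \<rho> * \<gamma>"
  have \<eta>: "\<eta> \<in> {1, -1}" "\<eta> * \<rho> = \<gamma>"
    using \<rho> signs by (auto simp: \<eta>_def)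
  define t' where "t' = t[i := (k, \<eta> * \<delta>)]"
  have "t' \<in> signed_orderings (s * \<delta> * \<rho> * (\<eta> * \<delta>)) (insert k (K - {k} - {j}))"
    using signed_orderings_replace [OF t i(1), of k "\<eta> * \<delta>"] \<eta> signs i by (auto simp: t'_def)
  moreover have "s * \<delta> * \<rho> * (\<eta> * \<delta>) = s * \<gamma>"
    unfolding \<eta>(2) [symmetric] using signs(1) by auto
  moreover have "insert k (K - {k} - {j}) = K - {j}"
    using jk by auto
  ultimately have t': "t' \<in> signed_orderings (s * \<gamma>) (K - {j})"
    by simp
  have "(k, \<delta>) # t \<in> signed_orderings s K"
    using t jk signs by (simp add: signed_orderings_Cons)
  then have "signed_var (((k, \<delta>) # t) ! 0) - of_int \<eta> * signed_var (((k, \<delta>) # t) ! Suc i) dvd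
      f (reflect ((k, \<delta>) # t) 0 (Suc i) \<eta>) - f ((k, \<delta>) # t)"
    using f \<eta>(1) i(1) unfolding gkm_on_def by (metis Suc_less_eq length_Cons zero_less_Suc)
  moreover have "of_int \<eta> * signed_var (t ! i) = of_int \<gamma> * Var j"
    by (simp add: i \<eta>(2) [symmetric])
  moreover have "reflect ((k, \<delta>) # t) 0 (Suc i) \<eta> = (j, \<gamma>) # t'"
    by (simp add: reflect_def t'_def i \<eta>)
  ultimately have "?d dvd f ((j, \<gamma>) # t') - f ((k, \<delta>) # t)"
    by simp
  \<comment> \<open>\<open>t'\<close> and \<open>t\<close> differ in one entry, and modulo
    \<open>?d\<close> the two entries agree. So \<open>t'\<close> may be replaced by
    \<open>t\<close> in the expansion over the vertex of \<open>j\<close>.\<close>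
  moreover have "?d dvd (\<Sum>J \<in> indices l. \<alpha> J j \<gamma> * (monomial_at t' J - monomial_at t J))"
  proof (intro dvd_sum dvd_mult)
    have "signed_var (k, \<eta> * \<delta>) - signed_var (t ! i) = of_int \<eta> * ?d"
      using \<eta>(1) by (auto simp: i \<eta>(2) [symmetric] algebra_simps)
    then have "?d dvd signed_var (k, \<eta> * \<delta>) - signed_var (t ! i)"
      by simp
    then show "?d dvd monomial_at t' J - monomial_at t J" for J
      unfolding t'_def by (rule monomial_at_update_dvd)
  qed
  ultimately have "?d dvd (\<Sum>J \<in> indices l. \<alpha> J j \<gamma> * (monomial_at t' J - monomial_at t J)) -
      (f ((j, \<gamma>) # t') - f ((k, \<delta>) # t))"
    by (simp only: dvd_diff)
  then show "?d dvd (\<Sum>J \<in> indices l. (\<alpha> J k \<delta> - \<alpha> J j \<gamma>) * monomial_at t J)"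
    unfolding \<alpha> [OF jk(1) signs(2) t'] \<alpha> [OF jk(2) signs(1) t]
    by (simp add: left_diff_distrib right_diff_distrib sum_subtractf)
qed (use K s signs jk J in auto)

lemma monomials_span:
  assumes "finite K" "card K = Suc l" "s \<in> {1, -1}" "gkm_on (signed_orderings s K) f"
  shows "\<exists>a. \<forall>t \<in> signed_orderings s K. f t = (\<Sum>I \<in> indices l. a I * monomial_at t I)"
  using assms
proof (induction l arbitrary: K s f)
  case 0
  then obtain k where "K = {k}"
    by (metis One_nat_def card_1_singletonE)
  then have "\<forall>t \<in> signed_orderings s K. t = [(k, s)]"
    using signed_orderings_singleton by blast
  then show ?case
    by (intro exI [of _ "\<lambda>_. f [(k, s)]"]) (auto simp: monomial_at_def)
next
  case (Suc l)
  let ?expands = "\<lambda>k \<delta> a. \<forall>t \<in> signed_orderings (s * \<delta>) (K - {k}).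
      f ((k, \<delta>) # t) = (\<Sum>J \<in> indices l. a J * monomial_at t J)"
  have "\<exists>a. ?expands k \<delta> a" if "k \<in> K" "\<delta> \<in> {1, -1}" for k \<delta>
    using Suc.prems that by (intro Suc.IH gkm_on_Cons) auto
  \<comment> \<open>One expansion is fixed per vertex, so that for each \<open>J\<close> the
    coefficients form a function on the vertices.\<close>
  then have "?expands k \<delta> (SOME a. ?expands k \<delta> a)" if "k \<in> K" "\<delta> \<in> {1, -1}" for k \<delta>
    by (rule someI_ex [of "?expands k \<delta>"]) (fact that)+
  moreover define \<alpha> where "\<alpha> = (\<lambda>J k \<delta>. (SOME a. ?expands k \<delta> a) J)"
  ultimately have \<alpha>: "f ((k, \<delta>) # t) = (\<Sum>J \<in> indices l. \<alpha> J k \<delta> * monomial_at t J)"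
    if "k \<in> K" "\<delta> \<in> {1, -1}" "t \<in> signed_orderings (s * \<delta>) (K - {k})" for k \<delta> t
    using that by (simp only:)
  have "\<forall>J \<in> indices l. \<exists>b b'. \<forall>k \<in> K. \<forall>\<delta> \<in> {1, -1}. \<alpha> J k \<delta> =
    (\<Sum>i\<le>2 * Suc l. b i * (of_int \<delta> * Var k) ^ i) + b' * (of_int \<delta> * (\<Prod>j \<in> K - {k}. Var j))"
  proof
    fix J assume J: "J \<in> indices l"
    show "\<exists>b b'. \<forall>k \<in> K. \<forall>\<delta> \<in> {1, -1}. \<alpha> J k \<delta> =
      (\<Sum>i\<le>2 * Suc l. b i * (of_int \<delta> * Var k) ^ i) + b' * (of_int \<delta> * (\<Prod>j \<in> K - {k}. Var j))"
      by (rule vertex_interpolation [OF Suc.prems(1,2)],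
          rule coefficients_vertex_condition [OF Suc.prems \<alpha> _ _ _ _ _ J]) auto
  qed
  then obtain b where "\<forall>J \<in> indices l. \<exists>b'. \<forall>k \<in> K. \<forall>\<delta> \<in> {1, -1}. \<alpha> J k \<delta> =
    (\<Sum>i\<le>2 * Suc l. b J i * (of_int \<delta> * Var k) ^ i) + b' * (of_int \<delta> * (\<Prod>j \<in> K - {k}. Var j))"
    by (rule bchoice [THEN exE])
  then obtain b' where "\<forall>J \<in> indices l. \<forall>k \<in> K. \<forall>\<delta> \<in> {1, -1}. \<alpha> J k \<delta> =
    (\<Sum>i\<le>2 * Suc l. b J i * (of_int \<delta> * Var k) ^ i) + b' J * (of_int \<delta> * (\<Prod>j \<in> K - {k}. Var j))"
    by (rule bchoice [THEN exE])
  then have b: "\<And>J k \<delta>. J \<in> indices l \<Longrightarrow> k \<in> K \<Longrightarrow> \<delta> \<in> {1, -1} \<Longrightarrow> \<alpha> J k \<delta> =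
    (\<Sum>i\<le>2 * Suc l. b J i * (of_int \<delta> * Var k) ^ i) + b' J * (of_int \<delta> * (\<Prod>j \<in> K - {k}. Var j))"
    by blast
  \<comment> \<open>The recursion for the indices is inverted by testing whether 0 occurs in the
    tail. The factor \<open>s\<close> cancels the one in the collected coefficient.\<close>
  define a where "a I = (if 0 \<in> set (tl I) then b (tl I) (hd I) else
      b' (map (\<lambda>i. i - 1) (tl I)) * of_int s)" for I
  have a1: "a (i # J) = b J i" if "J \<in> indices l" for i J
    using zero_in_indices [OF that] by (simp add: a_def)
  have a2: "a (0 # map Suc J) * of_int s = b' J" for J
    using Suc.prems(3) by (auto simp: a_def o_def)
  have "f t = (\<Sum>I \<in> indices (Suc l). a I * monomial_at t I)" if t: "t \<in> signed_orderings s K" for t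
  proof -
    obtain k \<delta> t' where t': "t = (k, \<delta>) # t'"
      using length_signed_orderings [OF t] Suc.prems(2) by (cases t) auto
    have *: "k \<in> K" "\<delta> \<in> {1, -1}" "t' \<in> signed_orderings (s * \<delta>) (K - {k})"
      using t by (simp_all add: t' signed_orderings_Cons)
    have card: "card (K - {k}) = Suc l"
      using * Suc.prems(1,2) by simp
    have "f t = (\<Sum>J \<in> indices l. \<alpha> J k \<delta> * monomial_at t' J)"
      using \<alpha> [OF *] by (simp add: t')
    also have "\<dots> = (\<Sum>I \<in> indices (Suc l). a I * monomial_at t I)"
      unfolding t' sum_indices_monomial_at_Cons [OF *(3) card] a2
      by (intro sum.cong refl) (simp only: a1 b [OF _ *(1,2)])
    finally show ?thesis .
  qed
  then show ?case by blast
qed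

section \<open>The module $H_\alpha^*(W)$\<close>

definition ordering_of :: "nat \<Rightarrow> signed_perm \<Rightarrow> (nat \<times> int) list"
  where "ordering_of n w = map (\<lambda>k. (fst w k, snd w k)) [1..<Suc n]"

lemma length_ordering_of [simp]: "length (ordering_of n w) = n"
  by (simp add: ordering_of_def)

lemma nth_ordering_of: "i < n \<Longrightarrow> ordering_of n w ! i = (fst w (Suc i), snd w (Suc i))"
  by (simp add: ordering_of_def del: upt_Suc)

lemma ordering_of_in_signed_orderings:
  assumes "w \<in> carrier (weyl_D n)"
  shows "ordering_of n w \<in> signed_orderings 1 {1..n}"
proof -
  obtain u \<epsilon> where w: "w = (u, \<epsilon>)"
    by (cases w)
  have *: "u permutes {1..n}" "\<And>k. k \<in> {1..n} \<Longrightarrow> \<epsilon> k \<in> {1, -1}" "(\<Prod>k = 1..n. \<epsilon> k) = 1"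
    using assms by (simp_all add: w weyl_D_carrier)
  have set: "set [1..<Suc n] = {1..n}"
    by auto
  have fst: "map fst (ordering_of n w) = map u [1..<Suc n]" and snd: "map snd (ordering_of n w) = map \<epsilon> [1..<Suc n]"
    by (simp_all add: ordering_of_def w o_def)
  have "distinct (map fst (ordering_of n w))"
    unfolding fst distinct_map set using *(1) by (simp add: permutes_inj_on del: upt_Suc)
  moreover have "fst ` set (ordering_of n w) = {1..n}"
    unfolding set_map [symmetric] fst using permutes_image [OF *(1)] set by (simp del: upt_Suc)
  moreover have "snd ` set (ordering_of n w) \<subseteq> {1, -1}"
    unfolding set_map [symmetric] snd set_map set using *(2) by blast
  moreover have "prod_list (map snd (ordering_of n w)) = 1"
    unfolding snd using *(3) prod.distinct_set_conv_list [of "[1..<Suc n]" \<epsilon>, unfolded set] by simp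
  ultimately show ?thesis
    by (simp add: signed_orderings_def)
qed

lemma inj_on_ordering_of: "inj_on (ordering_of n) (carrier (weyl_D n))"
proof (rule inj_onI)
  fix w w' assume w: "w \<in> carrier (weyl_D n)" "w' \<in> carrier (weyl_D n)" and eq: "ordering_of n w = ordering_of n w'"
  have "fst w k = fst w' k \<and> snd w k = snd w' k" for k
  proof (cases "k \<in> {1..n}")
    case True
    then obtain i where "k = Suc i" "i < n"
      by (cases k) auto
    then show ?thesis
      using arg_cong [OF eq, of "\<lambda>t. t ! i"] by (simp add: nth_ordering_of)
  next
    case False
    then show ?thesis
      using w by (cases w, cases w') (auto simp: weyl_D_carrier permutes_not_in simp del: atLeastAtMost_iff)
  qed
  then show "w = w'"
    by (simp add: prod_eq_iff fun_eq_iff)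
qed

lemma ordering_of_surj:
  assumes t: "t \<in> signed_orderings 1 {1..n}"
  shows "t \<in> ordering_of n ` carrier (weyl_D n)"
proof
  define u where "u = (\<lambda>k. if k \<in> {1..n} then fst (t ! (k - 1)) else k)"
  define \<epsilon> where "\<epsilon> = (\<lambda>k. if k \<in> {1..n} then snd (t ! (k - 1)) else 1)"
  have len: "length t = n"
    using length_signed_orderings [OF t] by simp
  show eq: "t = ordering_of n (u, \<epsilon>)"
    by (rule nth_equalityI) (simp_all add: len nth_ordering_of u_def \<epsilon>_def)
  have set: "set [1..<Suc n] = {1..n}"
    by auto
  have fst: "map fst t = map u [1..<Suc n]" and snd: "map snd t = map \<epsilon> [1..<Suc n]"
    unfolding eq by (simp_all add: ordering_of_def o_def)
  have "inj_on u {1..n}"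
  proof -
    have "distinct (map u [1..<Suc n])"
      using t unfolding fst [symmetric] by (simp only: signed_orderings_def mem_Collect_eq)
    then show ?thesis
      unfolding distinct_map set ..
  qed
  moreover have "u ` {1..n} = {1..n}"
  proof -
    have "set (map u [1..<Suc n]) = {1..n}"
      using t unfolding fst [symmetric] by (simp add: signed_orderings_def)
    then show ?thesis
      unfolding set_map set .
  qed
  ultimately have "u permutes {1..n}"
    by (intro bij_imp_permutes) (auto simp: bij_betw_def u_def)
  moreover have "\<epsilon> ` {1..n} \<subseteq> {1, -1}"
  proof -
    have "set (map \<epsilon> [1..<Suc n]) \<subseteq> {1, -1}"
      using t unfolding snd [symmetric] by (simp add: signed_orderings_def)
    then show ?thesis
      unfolding set_map set .
  qed
  moreover have "(\<Prod>k = 1..n. \<epsilon> k) = 1"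
    using t prod.distinct_set_conv_list [of "[1..<Suc n]" \<epsilon>, unfolded set snd [symmetric]]
    by (simp add: signed_orderings_def)
  moreover have "\<forall>k. k \<notin> {1..n} \<longrightarrow> \<epsilon> k = 1"
    by (simp add: \<epsilon>_def)
  ultimately show "(u, \<epsilon>) \<in> carrier (weyl_D n)"
    unfolding weyl_D_carrier by blast
qed

lemma c_class_eq_monomial_at:
  assumes "w \<in> carrier (weyl_D n)" "length I = n"
  shows "c_class n I w = monomial_at (ordering_of n w) I"
proof -
  obtain u \<epsilon> where w: "w = (u, \<epsilon>)"
    by (cases w)
  have "I = map (\<lambda>k. I ! (k - 1)) [1..<Suc n]"
    using assms(2) by (intro nth_equalityI) (simp_all del: upt_Suc)
  then have "monomial_at (ordering_of n w) I = monomial_at (ordering_of n w) (map (\<lambda>k. I ! (k - 1)) [1..<Suc n])"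
    by simp
  also have "\<dots> = prod_list (map (\<lambda>k. (of_int (\<epsilon> k) * Var (u k)) ^ (I ! (k - 1))) [1..<Suc n])"
    by (simp add: monomial_at_def ordering_of_def w zip_map_map zip_same_conv_map o_def del: upt_Suc)
  also have "\<dots> = (\<Prod>k \<in> set [1..<Suc n]. (of_int (\<epsilon> k) * Var (u k)) ^ (I ! (k - 1)))"
    by (rule prod.distinct_set_conv_list [symmetric]) simp
  also have "set [1..<Suc n] = {1..n}"
    by auto
  finally show ?thesis
    using assms(1) by (simp add: c_class_def w)
qed

text \<open>The class is the orbit map of a single monomial; both its invariance and its
  divisibility conditions follow from this.\<close>

lemma c_class_eq_act:
  assumes "w \<in> carrier (weyl_D n)"
  shows "c_class n I w = act w (\<Prod>k = 1..n. Var k ^ (I ! (k - 1)))"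
  using assms
  by (cases w) (simp add: c_class_def act_def poly_subst_prod poly_subst_power)

lemma act_mult: "act w (p * q) = act w p * act w q"
  by (simp add: act_def poly_subst_mult)

lemma act_diff: "act w (p - q) = act w p - act w q"
  by (simp add: act_def poly_subst_diff)

lemma act_monomial: "act w (\<Prod>k \<in> A. p k ^ i k) = (\<Prod>k \<in> A. act w (p k) ^ i k)"
  by (simp add: act_def poly_subst_prod poly_subst_power)

lemma act_in_polys:
  assumes "w \<in> carrier (weyl_D n)" "p \<in> polys n"
  shows "act w p \<in> polys n"
proof -
  obtain u \<epsilon> where w: "w = (u, \<epsilon>)"
    by (cases w)
  have "act w (Var k) \<in> polys n" if "k \<in> {1..n}" for k
  proof -
    have "u k \<in> {1..n}"
      using assms(1) that permutes_in_image [of u "{1..n}" k] by (simp add: w weyl_D_carrier)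
    moreover have "of_int (\<epsilon> k) \<in> polys n"
    proof -
      have "\<epsilon> k = 1 \<or> \<epsilon> k = -1"
        using assms(1) that by (auto simp: w weyl_D_carrier)
      then show ?thesis by auto
    qed
    ultimately show ?thesis
      using Var_in_polys by (simp add: w act_Var)
  qed
  \<comment> \<open>Setting the images of the other variables to 0 does not affect \<open>p\<close>
    and puts all images in \<open>polys n\<close>.\<close>
  then have "poly_subst (\<lambda>k. if k \<in> {1..n} then act w (Var k) else 0) p \<in> polys n"
    by (intro poly_subst_in_polys) simp
  also have "poly_subst (\<lambda>k. if k \<in> {1..n} then act w (Var k) else 0) p = act w p"
    unfolding act_def poly_subst_Var unfolding poly_subst_def
    using assms(2) by (intro sum.cong prod.cong refl arg_cong2 [of _ _ _ _ "(*)"]) (force simp: polys_def)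
  finally show ?thesis .
qed

lemma act_weyl_mult: "act (w \<otimes>\<^bsub>weyl_D n\<^esub> v) (\<Prod>k \<in> A. Var k ^ i k) = act w (act v (\<Prod>k \<in> A. Var k ^ i k))"
  by (simp add: act_monomial act_mult_Var)

lemma refl_elt_signed:
  assumes "i < j" "j < n" "\<eta> \<in> {1, -1}"
  shows "refl_elt n (Var (Suc i) - of_int \<eta> * Var (Suc j)) =
      (Transposition.transpose (Suc i) (Suc j), \<lambda>k. if k = Suc i \<or> k = Suc j then \<eta> else 1)"
    and "Var (Suc i) - of_int \<eta> * Var (Suc j) \<in> pos_roots n"
proof -
  show "refl_elt n (Var (Suc i) - of_int \<eta> * Var (Suc j)) =
      (Transposition.transpose (Suc i) (Suc j), \<lambda>k. if k = Suc i \<or> k = Suc j then \<eta> else 1)"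
    using refl_elt_aux(2) [of "- \<eta>" "Suc i" "Suc j" n] assms by (auto simp: fun_eq_iff)
  have "1 \<le> Suc i" "Suc i < Suc j" "Suc j \<le> n"
    using assms by simp_all
  moreover have "Var (Suc i) - of_int \<eta> * Var (Suc j) \<in> {Var (Suc i) - Var (Suc j), Var (Suc i) + Var (Suc j)}"
    using assms(3) by auto
  ultimately show "Var (Suc i) - of_int \<eta> * Var (Suc j) \<in> pos_roots n"
    unfolding pos_roots_def by blast
qed

lemma pos_roots_signed:
  assumes "\<beta> \<in> pos_roots n"
  obtains i j \<eta> where "i < j" "j < n" "\<eta> \<in> {1, -1 :: int}" "\<beta> = Var (Suc i) - of_int \<eta> * Var (Suc j)"
  using assms unfolding pos_roots_def
proof (elim UnE CollectE exE conjE)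
  fix i j assume "\<beta> = Var i - Var j" "1 \<le> i" "i < j" "j \<le> n"
  then show ?thesis
    using that [of "i - 1" "j - 1" 1] by simp
next
  fix i j assume "\<beta> = Var i + Var j" "1 \<le> i" "i < j" "j \<le> n"
  then show ?thesis
    using that [of "i - 1" "j - 1" "-1"] by simp
qed

lemma c_class_in_H_carrier: "c_class n I \<in> H_carrier n"
proof -
  let ?m = "\<Prod>k = 1..n. Var k ^ (I ! (k - 1))"
  have Var: "prod (\<lambda>k. Var k ^ i k) A \<in> polys n" if "A \<subseteq> {1..n}" for i and A :: "nat set"
  proof -
    have "q ^ i \<in> polys n" if "q \<in> polys n" for q i
      using that by (induction i) simp_all
    then show ?thesis
      using that by (induction A rule: infinite_finite_induct) (simp_all add: Var_in_polys)
  qed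
  have m: "?m \<in> polys n"
    by (rule Var) simp
  have "c_class n I = (\<lambda>v \<in> carrier (weyl_D n). act v ?m)"
    by (rule extensionalityI [of _ "carrier (weyl_D n)"]) (simp add: c_class_def, simp, simp add: c_class_eq_act)
  moreover have "(\<lambda>v \<in> carrier (weyl_D n). act v ?m) \<in> H_carrier n"
  proof (rule H_carrierI)
    fix w s \<beta>
    assume w: "w \<in> carrier (weyl_D n)" and \<beta>: "\<beta> \<in> pos_roots n"
      and s: "s = w \<otimes>\<^bsub>weyl_D n\<^esub> refl_elt n \<beta>" "s \<in> carrier (weyl_D n)"
    obtain i j \<eta> where ij: "i < j" "j < n" "\<eta> \<in> {1, -1 :: int}" "\<beta> = Var (Suc i) - of_int \<eta> * Var (Suc j)"
      using pos_roots_signed [OF \<beta>] by blast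
    \<comment> \<open>A reflection moves each variable by a multiple of its root, here by
      \<open>- \<beta>\<close>, \<open>\<eta> * \<beta>\<close> or 0. The same then holds for
      monomials, and applying \<open>w\<close> carries the root to
      \<open>act w \<beta>\<close>.\<close>
    have "\<beta> dvd of_int (snd (refl_elt n \<beta>) k) * Var (fst (refl_elt n \<beta>) k) - Var k" for k
    proof -
      consider "k = Suc i" | "k = Suc j" | "k \<noteq> Suc i" "k \<noteq> Suc j"
        by blast
      then show ?thesis
      proof cases
        case 1
        then have "of_int (snd (refl_elt n \<beta>) k) * Var (fst (refl_elt n \<beta>) k) - Var k = \<beta> * (- 1)"
          using refl_elt_signed(1) [OF ij(1-3)] by (simp add: ij(4))
        then show ?thesis by (metis dvd_triv_left)
      next
        case 2
        then have "of_int (snd (refl_elt n \<beta>) k) * Var (fst (refl_elt n \<beta>) k) - Var k = \<beta> * of_int \<eta>"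
          using refl_elt_signed(1) [OF ij(1-3)] ij(3) by (auto simp add: ij(4) algebra_simps)
        then show ?thesis by (metis dvd_triv_left)
      next
        case 3
        then show ?thesis
          using refl_elt_signed(1) [OF ij(1-3)] by (simp add: ij(4) transpose_apply_other)
      qed
    qed
    then have "\<beta> dvd poly_subst (\<lambda>k. of_int (snd (refl_elt n \<beta>) k) * Var (fst (refl_elt n \<beta>) k)) ?m -
        poly_subst Var ?m"
      by (rule poly_subst_cong_dvd)
    then have "\<beta> dvd act (refl_elt n \<beta>) ?m - ?m"
      by (simp only: act_def poly_subst_id)
    then obtain q where "act (refl_elt n \<beta>) ?m - ?m = \<beta> * q" ..
    then have "act w (act (refl_elt n \<beta>) ?m - ?m) = act w \<beta> * act w q"
      by (simp only: act_mult)
    then have "act w \<beta> dvd act w (act (refl_elt n \<beta>) ?m - ?m)"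
      by (rule dvdI)
    then have "act w \<beta> dvd act s ?m - act w ?m"
      by (simp add: s(1) act_weyl_mult act_diff)
    moreover have "\<beta> \<in> polys n"
    proof -
      have "of_int \<eta> \<in> polys n"
        using ij(3) by auto
      then show ?thesis
        using ij(1,2) by (simp add: ij(4) Var_in_polys)
    qed
    ultimately show "\<exists>q \<in> polys n. act s ?m - act w ?m = act w \<beta> * q"
      using w s(2) m by (intro dvd_imp_polys_quotient polys_diff act_in_polys)
  qed (rule act_in_polys [OF _ m])
  ultimately show ?thesis by simp
qed

lemma W_invariant_c_class: "W_invariant n (c_class n I)"
proof -
  interpret group "weyl_D n" by (rule group_weyl_D)
  have "class_act n w (c_class n I) = c_class n I" if w: "w \<in> carrier (weyl_D n)" for w
  proof (rule extensionalityI [of _ "carrier (weyl_D n)"])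
    fix v assume v: "v \<in> carrier (weyl_D n)"
    have "inv\<^bsub>weyl_D n\<^esub> w \<otimes>\<^bsub>weyl_D n\<^esub> (w \<otimes>\<^bsub>weyl_D n\<^esub> v) = v"
      using w v by (simp flip: m_assoc)
    then have "act (inv\<^bsub>weyl_D n\<^esub> w) (c_class n I (w \<otimes>\<^bsub>weyl_D n\<^esub> v)) = c_class n I v"
      unfolding c_class_eq_act [OF m_closed [OF w v]] c_class_eq_act [OF v]
        act_weyl_mult [symmetric, where n = n] by simp
    then show "class_act n w (c_class n I) v = c_class n I v"
      using v by (simp add: class_act_def)
  qed (simp_all add: class_act_def c_class_def)
  then show ?thesis
    by (simp add: W_invariant_def)
qed

lemma ordering_of_mult_refl_elt:
  assumes "i < j" "j < n" "\<eta> \<in> {1, -1}"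
  shows "ordering_of n (w \<otimes>\<^bsub>weyl_D n\<^esub> refl_elt n (Var (Suc i) - of_int \<eta> * Var (Suc j))) =
    reflect (ordering_of n w) i j \<eta>"
proof (rule nth_equalityI)
  obtain u \<epsilon> where w: "w = (u, \<epsilon>)"
    by (cases w)
  fix k assume "k < length (ordering_of n (w \<otimes>\<^bsub>weyl_D n\<^esub> refl_elt n (Var (Suc i) - of_int \<eta> * Var (Suc j))))"
  then have "k < n" by simp
  then show "ordering_of n (w \<otimes>\<^bsub>weyl_D n\<^esub> refl_elt n (Var (Suc i) - of_int \<eta> * Var (Suc j))) ! k =
      reflect (ordering_of n w) i j \<eta> ! k"
    unfolding refl_elt_signed(1) [OF assms] w weyl_D_mult using assms(1,2)
    by (auto simp: reflect_def nth_ordering_of nth_list_update transpose_def)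
qed (simp add: reflect_def)

text \<open>The class is transported along the bijection between group elements and orderings;
  \<open>act w \<beta>\<close> becomes the signed combination of two entries of the
  ordering.\<close>

lemma gkm_on_H_carrier:
  assumes f: "f \<in> H_carrier n"
  shows "gkm_on (signed_orderings 1 {1..n}) (\<lambda>t. f (inv_into (carrier (weyl_D n)) (ordering_of n) t))"
  unfolding gkm_on_def
proof (intro ballI allI impI)
  interpret group "weyl_D n" by (rule group_weyl_D)
  let ?inv = "inv_into (carrier (weyl_D n)) (ordering_of n)"
  fix t i j and \<eta> :: int
  assume t: "t \<in> signed_orderings 1 {1..n}" and \<eta>: "\<eta> \<in> {1, -1}" and ij: "i < j" "j < length t"
  obtain w where w: "w \<in> carrier (weyl_D n)" "t = ordering_of n w"
    using ordering_of_surj [OF t] by blast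
  have j: "j < n"
    using ij w by simp
  define \<beta> where "\<beta> = Var (Suc i) - of_int \<eta> * Var (Suc j)"
  have \<beta>: "\<beta> \<in> pos_roots n"
    unfolding \<beta>_def by (rule refl_elt_signed(2) [OF ij(1) j \<eta>])
  have inv: "?inv (ordering_of n v) = v" if "v \<in> carrier (weyl_D n)" for v
    using inj_on_ordering_of that by (rule inv_into_f_f)
  have "act w \<beta> dvd f (w \<otimes>\<^bsub>weyl_D n\<^esub> refl_elt n \<beta>) - f w"
    using H_carrierD(2) [OF f w(1) \<beta>] by auto
  moreover have "act w \<beta> = signed_var (t ! i) - of_int \<eta> * signed_var (t ! j)"
    using ij j by (simp add: \<beta>_def w(2) nth_ordering_of act_def poly_subst_diff poly_subst_mult)
  moreover have "?inv (reflect t i j \<eta>) = w \<otimes>\<^bsub>weyl_D n\<^esub> refl_elt n \<beta>"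
    using inv [of "w \<otimes>\<^bsub>weyl_D n\<^esub> refl_elt n \<beta>"] w refl_elt_closed [OF \<beta>]
      ordering_of_mult_refl_elt [OF ij(1) j \<eta>, of w] by (simp add: \<beta>_def)
  ultimately show "signed_var (t ! i) - of_int \<eta> * signed_var (t ! j) dvd f (?inv (reflect t i j \<eta>)) - f (?inv t)"
    using inv [OF w(1)] w(2) by simp
qed

section \<open>Transfer to a basis of the module\<close>

lemma c_classes_span:
  assumes "f \<in> H_carrier (Suc l)"
  obtains a where "\<And>I. a I \<in> polys (Suc l)"
    "\<And>w. w \<in> carrier (weyl_D (Suc l)) \<Longrightarrow> f w = (\<Sum>I \<in> indices l. a I * c_class (Suc l) I w)"
proof -
  let ?n = "Suc l"
  obtain a where a: "\<And>t. t \<in> signed_orderings 1 {1..?n} \<Longrightarrow>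
      f (inv_into (carrier (weyl_D ?n)) (ordering_of ?n) t) = (\<Sum>I \<in> indices l. a I * monomial_at t I)"
    using monomials_span [OF _ _ _ gkm_on_H_carrier [OF assms]] by auto
  have "f w = (\<Sum>I \<in> indices l. truncate_vars ?n (a I) * c_class ?n I w)"
    if w: "w \<in> carrier (weyl_D ?n)" for w
  proof -
    have "f w = (\<Sum>I \<in> indices l. a I * c_class ?n I w)"
      using a [OF ordering_of_in_signed_orderings [OF w]] inv_into_f_f [OF inj_on_ordering_of w]
      by (simp add: c_class_eq_monomial_at [OF w] length_indices)
    \<comment> \<open>The coefficients may still contain other variables; the retraction removes
      these and fixes the values of \<open>f\<close> and of the classes.\<close>
    then have "truncate_vars ?n (f w) = truncate_vars ?n (\<Sum>I \<in> indices l. a I * c_class ?n I w)"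
      by simp
    also have "\<dots> = (\<Sum>I \<in> indices l. truncate_vars ?n (a I) * truncate_vars ?n (c_class ?n I w))"
      by (simp add: truncate_vars_def poly_subst_sum poly_subst_mult)
    finally show ?thesis
      using H_carrierD(1) [OF assms w] H_carrierD(1) [OF c_class_in_H_carrier w]
      by (simp add: truncate_vars_ident)
  qed
  then show ?thesis
    by (intro that [of "\<lambda>I. truncate_vars ?n (a I)"] truncate_vars_in_polys)
qed

text \<open>Independence modulo \<open>d\<close> in the case \<open>d = 0\<close>, where
  divisibility means vanishing.\<close>

lemma c_classes_independent:
  assumes "\<And>w. w \<in> carrier (weyl_D (Suc l)) \<Longrightarrow> (\<Sum>I \<in> indices l. a I * c_class (Suc l) I w) = 0"
    and "I \<in> indices l"
  shows "a I = 0"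
proof -
  have "0 dvd a I"
  proof (rule monomials_independent [of "{1..Suc l}" l 1])
    fix t assume "t \<in> signed_orderings 1 {1..Suc l}"
    then obtain w where w: "w \<in> carrier (weyl_D (Suc l))" "t = ordering_of (Suc l) w"
      using ordering_of_surj by blast
    then show "0 dvd (\<Sum>I \<in> indices l. a I * monomial_at t I)"
      using assms(1) [OF w(1)] by (simp add: c_class_eq_monomial_at [OF w(1)] length_indices)
  qed (use assms(2) in \<open>simp_all add: splits_products_0 Var_nonzero Var_square_eq_iff\<close>)
  then show ?thesis by simp
qed

text \<open>Two equal classes would give a relation with coefficients 1 and -1. Injectivity lets
  sums over indices be rewritten as sums over the set of classes.\<close>

lemma c_class_inj_on: "inj_on (c_class (Suc l)) (indices l)"
proof (rule inj_onI, rule ccontr)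
  fix I J assume IJ: "I \<in> indices l" "J \<in> indices l" "c_class (Suc l) I = c_class (Suc l) J" "I \<noteq> J"
  define a :: "nat list \<Rightarrow> rpoly" where "a = (\<lambda>L. (if L = I then 1 else 0) - (if L = J then 1 else 0))"
  have "(\<Sum>L \<in> indices l. a L * c_class (Suc l) L w) = 0" for w
  proof -
    have "(\<Sum>L \<in> indices l. a L * c_class (Suc l) L w) =
        (\<Sum>L \<in> indices l. (if L = I then c_class (Suc l) L w else 0) - (if L = J then c_class (Suc l) L w else 0))"
      by (intro sum.cong) (auto simp: a_def)
    also have "\<dots> = 0"
      using IJ by (simp add: sum_subtractf)
    finally show ?thesis .
  qed
  then have "a I = 0"
    using c_classes_independent IJ(1) by blast
  then show False
    using IJ(4) by (simp add: a_def)
qed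

lemma H_alpha_finsum:
  assumes "finite F" "F \<subseteq> H_carrier n" "a \<in> F \<rightarrow> polys n"
  shows "(\<Oplus>\<^bsub>H_alpha n\<^esub>b \<in> F. a b \<odot>\<^bsub>H_alpha n\<^esub> b) = (\<lambda>v \<in> carrier (weyl_D n). \<Sum>b \<in> F. a b * b v)"
proof -
  interpret algebra "poly_ring n" "H_alpha n" by (rule algebra_H_alpha)
  show ?thesis
    using assms
  proof (induction F rule: finite_induct)
    case empty
    have "\<zero>\<^bsub>H_alpha n\<^esub> = (\<lambda>v \<in> carrier (weyl_D n). 0)"
      by (simp add: H_alpha_def)
    then show ?case by simp
  next
    case (insert f F)
    have "(\<lambda>b. a b \<odot>\<^bsub>H_alpha n\<^esub> b) \<in> insert f F \<rightarrow> carrier (H_alpha n)"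
      using insert.prems by (auto simp: H_alpha_def Pi_iff intro!: H_carrier_smult)
    then have "(\<Oplus>\<^bsub>H_alpha n\<^esub>b \<in> insert f F. a b \<odot>\<^bsub>H_alpha n\<^esub> b) =
        a f \<odot>\<^bsub>H_alpha n\<^esub> f \<oplus>\<^bsub>H_alpha n\<^esub> (\<Oplus>\<^bsub>H_alpha n\<^esub>b \<in> F. a b \<odot>\<^bsub>H_alpha n\<^esub> b)"
      using insert.hyps by (intro finsum_insert) auto
    also have "(\<Oplus>\<^bsub>H_alpha n\<^esub>b \<in> F. a b \<odot>\<^bsub>H_alpha n\<^esub> b) = (\<lambda>v \<in> carrier (weyl_D n). \<Sum>b \<in> F. a b * b v)"
      using insert.prems by (intro insert.IH) auto
    finally show ?case
      using insert.hyps by (auto simp: H_alpha_def)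
  qed
qed

lemma module_basis_c_classes:
  "module_basis (poly_ring (Suc l)) (H_alpha (Suc l)) (c_class (Suc l) ` indices l)"
  unfolding module_basis_def
proof (intro conjI ballI allI impI)
  let ?n = "Suc l" and ?c = "c_class (Suc l)"
  have R: "carrier (poly_ring ?n) = polys ?n" "\<zero>\<^bsub>poly_ring ?n\<^esub> = 0"
    and H: "carrier (H_alpha ?n) = H_carrier ?n" "\<zero>\<^bsub>H_alpha ?n\<^esub> = (\<lambda>v \<in> carrier (weyl_D ?n). 0)"
    by (simp_all add: poly_ring_def H_alpha_def)
  show sub: "?c ` indices l \<subseteq> carrier (H_alpha ?n)"
    using c_class_in_H_carrier by (auto simp: H)
  show "\<exists>F a. finite F \<and> F \<subseteq> ?c ` indices l \<and> a \<in> F \<rightarrow> carrier (poly_ring ?n) \<and>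
      f = (\<Oplus>\<^bsub>H_alpha ?n\<^esub>b \<in> F. a b \<odot>\<^bsub>H_alpha ?n\<^esub> b)" if "f \<in> carrier (H_alpha ?n)" for f
  proof -
    have f: "f \<in> H_carrier ?n"
      using that by (simp add: H)
    obtain a where a: "\<And>I. a I \<in> polys ?n"
      "\<And>w. w \<in> carrier (weyl_D ?n) \<Longrightarrow> f w = (\<Sum>I \<in> indices l. a I * ?c I w)"
      using c_classes_span [OF f] by blast
    define a' where "a' = a \<circ> inv_into (indices l) ?c"
    have "f = (\<lambda>v \<in> carrier (weyl_D ?n). \<Sum>b \<in> ?c ` indices l. a' b * b v)"
    proof (rule extensionalityI [OF H_carrierD(3) [OF f]])
      fix w assume "w \<in> carrier (weyl_D ?n)"
      then show "f w = (\<lambda>v \<in> carrier (weyl_D ?n). \<Sum>b \<in> ?c ` indices l. a' b * b v) w"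
        using a(2) by (simp add: sum.reindex [OF c_class_inj_on] a'_def inv_into_f_f [OF c_class_inj_on])
    qed simp
    then have "f = (\<Oplus>\<^bsub>H_alpha ?n\<^esub>b \<in> ?c ` indices l. a' b \<odot>\<^bsub>H_alpha ?n\<^esub> b)"
      using sub a(1) by (subst H_alpha_finsum) (auto simp: H a'_def)
    then show ?thesis
      using a(1) by (intro exI [of _ "?c ` indices l"] exI [of _ a']) (auto simp: R a'_def)
  qed
  fix F a b
  assume F: "finite F \<and> F \<subseteq> ?c ` indices l \<and> a \<in> F \<rightarrow> carrier (poly_ring ?n) \<and>
      (\<Oplus>\<^bsub>H_alpha ?n\<^esub>b \<in> F. a b \<odot>\<^bsub>H_alpha ?n\<^esub> b) = \<zero>\<^bsub>H_alpha ?n\<^esub>" and b: "b \<in> F"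
  have zero: "(\<lambda>v \<in> carrier (weyl_D ?n). \<Sum>b \<in> F. a b * b v) = (\<lambda>v \<in> carrier (weyl_D ?n). 0)"
  proof -
    have "F \<subseteq> H_carrier ?n"
      using F sub unfolding H by blast
    then show ?thesis
      using F H_alpha_finsum [of F ?n a] by (simp add: R H)
  qed
  \<comment> \<open>A relation on a finite subset is extended by 0 to all indices.\<close>
  define a' where "a' = (\<lambda>I. if ?c I \<in> F then a (?c I) else 0)"
  obtain I where I: "I \<in> indices l" "b = ?c I"
    using F b by blast
  have "a' I = 0"
  proof (rule c_classes_independent [OF _ I(1)])
    fix w assume w: "w \<in> carrier (weyl_D ?n)"
    have "(\<Sum>I \<in> indices l. a' I * ?c I w) = (\<Sum>b \<in> ?c ` indices l. (if b \<in> F then a b else 0) * b w)"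
      by (simp add: sum.reindex [OF c_class_inj_on] a'_def)
    also have "\<dots> = (\<Sum>b \<in> F. a b * b w)"
      using F by (intro sum.mono_neutral_cong_right) auto
    also have "\<dots> = 0"
      using fun_cong [OF zero, of w] w by simp
    finally show "(\<Sum>I \<in> indices l. a' I * ?c I w) = 0" .
  qed
  then show "a b = \<zero>\<^bsub>poly_ring ?n\<^esub>"
    using b by (simp add: R a'_def I(2))
qed

theorem mainTheorem9:
  fixes n :: nat
  assumes "n \<ge> 3"
  shows "inj_on (c_class n) (D_indices n) \<and>
    module_basis (poly_ring n) (H_alpha n) {c_class n I | I. I \<in> D_indices n} \<and>
    (\<forall>I \<in> D_indices n. W_invariant n (c_class n I))"
proof -
  obtain l where n: "n = Suc (Suc l)"
    using assms that [of "n - 2"] by simp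
  have "{c_class n I | I. I \<in> D_indices n} = c_class n ` indices (Suc l)"
    unfolding n D_indices_eq_indices by blast
  then show ?thesis
    using c_class_inj_on [of "Suc l"] module_basis_c_classes [of "Suc l"] W_invariant_c_class
    by (simp add: n D_indices_eq_indices)
qed

end
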